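(* Let $\Gamma\stackrel{\mathcal{T}}{\Rightarrow}\Delta$ be a possibly infinite tree sequent. If $\mathfrak{M},f\models\Gamma\stackrel{\mathcal{T}}{\Rightarrow}\Delta$ for all models $\mathfrak{M}$ and all $\mathcal{T}$-assignments $f$ in $\mathfrak{M}$, then $\Gamma\stackrel{\mathcal{T}}{\Rightarrow}\Delta$ is provable in $\mathsf{T}\mathbf{EFL}^{-}$.
   Context: Syntax. Disjoint countably infinite sets $\mathsf{Prop}$ and $\mathsf{Nom}$ (agent nominals). Formulas: $\varphi ::= n \mid p \mid \bot \mid \varphi\to\varphi \mid @_{n}\varphi \mid \mathsf{F}\varphi \mid \Box\varphi$; $\neg\varphi:=\varphi\to\bot$; $\langle\mathsf{F}\rangle\varphi:=\neg\mathsf{F}\neg\varphi$. $@$-prefixed formulas have the form $@_n\varphi$. $\varphi[m/k]$ replaces every occurrence of nominal $k$ by $m$. Semantics. A model $\mathfrak{M}=(W,A,(R_a)_{a\in A},(\asymp_w)_{w\in W},V)$: $W,A$ nonempty, $R_a\subseteq W\times W$, $\asymp_w\subseteq A\times A$, $V:\mathsf{Prop}\cup\mathsf{Nom}\to\mathcal{P}(W\times A)$ with $V(n)=W\times\{\underline n\}$ for a unique $\underline n\in A$. Satisfaction: $(w,a)\models p$ iff $(w,a)\in V(p)$; $(w,a)\models n$ iff $\underline n=a$; $\bot$ never; $\to$ classical; $(w,a)\models@_n\varphi$ iff $(w,\underline n)\models\varphi$; $(w,a)\models\mathsf{F}\varphi$ iff $(w,b)\models\varphi$ for all $b$ with $a\asymp_wb$;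 $(w,a)\models\Box\varphi$ iff $(v,a)\models\varphi$ for all $v$ with $wR_av$. Tree sequents. Labels: natural numbers, and $\alpha\cdot_ni$ (an $n$-child of $\alpha$). A tree: set of labels with exactly one natural number (root), closed under parents. Labelled formula: $\alpha:\psi$, $\psi$ $@$-prefixed. A finite tree sequent $\Gamma\stackrel{\mathcal{T}}{\Rightarrow}\Delta$ has finite $\Gamma,\Delta$ (sets of labelled formulas) and finite tree $\mathcal{T}$ containing their labels; a possibly infinite tree sequent allows $\Gamma,\Delta,\mathcal{T}$ to be countably infinite. A $\mathcal{T}$-assignment is $f:\mathcal{T}\to W$ with $f(\alpha)R_{\underline n}f(\beta)$ whenever $\beta\in\mathcal{T}$ is an $n$-child of $\alpha$. $\mathfrak{M},f\models\alpha:@_n\varphi$ iff $(f(\alpha),\underline n)\models\varphi$; $\mathfrak{M},f\models\Gamma\stackrel{\mathcal{T}}{\Rightarrow}\Delta$ iff truth of all of $\Gamma$ implies truth of some member of $\Delta$. Calculus $\mathsf{T}\mathbf{EFL}^{-}$ on finite tree sequents ($\alpha,\beta\in\mathcal{T}$; tree unchanged unless indicated). Initial: $\alpha:@_n\bot,\Gamma\Rightarrow\Delta$; $\alpha:@_n\varphi,\Gamma\Rightarrow\Delta,\alpha:@_n\varphi$. Rules (premises / conclusion): $(\mathsf{rep}_{=1})$ $\alpha:@_nm,\alpha:\varphi[n/k],\Gamma\Rightarrow\Delta$ / $\alpha:@_nm,\alpha:\varphi[m/k],\Gamma\Rightarrow\Delta$; $(\mathsf{rep}_{=2})$ $\alpha:@_nm,\alpha:\varphi[m/k],\Gamma\Rightarrow\Delta$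 / $\alpha:@_nm,\alpha:\varphi[n/k],\Gamma\Rightarrow\Delta$; $(\mathsf{ref}_=)$ $\alpha:@_nn,\Gamma\Rightarrow\Delta$ / $\Gamma\Rightarrow\Delta$; $(\mathsf{rigid}_=)$ $\beta:@_nm,\Gamma\Rightarrow\Delta$ / $\alpha:@_nm,\Gamma\Rightarrow\Delta$; $(\to R)$ $\alpha:@_n\varphi,\Gamma\Rightarrow\Delta,\alpha:@_n\psi$ / $\Gamma\Rightarrow\Delta,\alpha:@_n(\varphi\to\psi)$; $(\to L)$ $\Gamma\Rightarrow\Delta,\alpha:@_n\varphi$ and $\alpha:@_n\psi,\Gamma\Rightarrow\Delta$ / $\alpha:@_n(\varphi\to\psi),\Gamma\Rightarrow\Delta$; $(@R)$ $\Gamma\Rightarrow\Delta,\alpha:@_m\varphi$ / $\Gamma\Rightarrow\Delta,\alpha:@_n@_m\varphi$; $(@L)$ $\alpha:@_m\varphi,\Gamma\Rightarrow\Delta$ / $\alpha:@_n@_m\varphi,\Gamma\Rightarrow\Delta$; $(\mathsf{F}R)$ $\alpha:@_n\langle\mathsf{F}\rangle m,\Gamma\Rightarrow\Delta,\alpha:@_m\varphi$ / $\Gamma\Rightarrow\Delta,\alpha:@_n\mathsf{F}\varphi$, $m$ not in the conclusion; $(\mathsf{F}L)$ $\Gamma\Rightarrow\Delta,\alpha:@_n\langle\mathsf{F}\rangle m$ and $\alpha:@_m\varphi,\Gamma\Rightarrow\Delta$ / $\alpha:@_n\mathsf{F}\varphi,\Gamma\Rightarrow\Delta$; $(\Box R)$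 $\Gamma\stackrel{\mathcal{T}\cup\{\alpha\cdot_ni\}}{\Rightarrow}\Delta,\alpha\cdot_ni:@_n\varphi$ / $\Gamma\stackrel{\mathcal{T}}{\Rightarrow}\Delta,\alpha:@_n\Box\varphi$, $i$ fresh in the conclusion; $(\Box L)$ $\beta:@_n\varphi,\Gamma\Rightarrow\Delta$ / $\alpha:@_n\Box\varphi,\Gamma\Rightarrow\Delta$, $\beta$ an $n$-child of $\alpha$; $(w\mathsf{lab})$ $\Gamma\stackrel{\mathcal{T}}{\Rightarrow}\Delta$ / $\Gamma\stackrel{\mathcal{T}\cup\{\alpha\}}{\Rightarrow}\Delta$ if $\mathcal{T}\cup\{\alpha\}$ is a tree. (No cut rule.) A possibly infinite tree sequent $\Gamma\stackrel{\mathcal{T}}{\Rightarrow}\Delta$ is provable in $\mathsf{T}\mathbf{EFL}^{-}$ if some $\Gamma'\stackrel{\mathcal{T}'}{\Rightarrow}\Delta'$ with finite $\Gamma'\subseteq\Gamma$, $\Delta'\subseteq\Delta$ and finite subtree $\mathcal{T}'\subseteq\mathcal{T}$ has a finite derivation. *)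

theory Defs
  imports "HOL-Library.Countable" "HOL-Library.Infinite_Typeclass"
begin

datatype (props: 'p, noms: 'n) fm =
    Nom 'n
  | Pro 'p
  | Bot
  | Imp "('p, 'n) fm" "('p, 'n) fm"
  | At 'n "('p, 'n) fm"
  | Fr "('p, 'n) fm"
  | Box "('p, 'n) fm"

definition Neg :: "('p, 'n) fm \<Rightarrow> ('p, 'n) fm" where
  "Neg \<phi> = Imp \<phi> Bot"

definition DiaF :: "('p, 'n) fm \<Rightarrow> ('p, 'n) fm" where
  "DiaF \<phi> = Neg (Fr (Neg \<phi>))"

definition at_prefixed :: "('p, 'n) fm \<Rightarrow> bool" where
  "at_prefixed \<psi> \<longleftrightarrow> (\<exists>n \<phi>. \<psi> = At n \<phi>)"

text \<open>\<open>subst \<phi> m k\<close> is \<open>\<phi>[m/k]\<close>: every occurrence of \<open>k\<close>, including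
  those as index of an \<open>At\<close>, becomes \<open>m\<close>.\<close>

definition subst :: "('p, 'n) fm \<Rightarrow> 'n \<Rightarrow> 'n \<Rightarrow> ('p, 'n) fm" where
  "subst \<phi> m k = map_fm id (id(k := m)) \<phi>"


subsection \<open>Models\<close>

text \<open>The valuation is defined on the disjoint union of propositional variables and nominals.
  Worlds and agents are carrier sets, so that models of all sizes up to that of the
  types \<open>'w\<close> and \<open>'a\<close> are covered.\<close>

record ('w, 'a, 'p, 'n) model =
  worlds :: "'w set"
  agents :: "'a set"
  know   :: "'a \<Rightarrow> ('w \<times> 'w) set"
  friend :: "'w \<Rightarrow> ('a \<times> 'a) set"
  val    :: "'p + 'n \<Rightarrow> ('w \<times> 'a) set"

definition is_model :: "('w, 'a, 'p, 'n) model \<Rightarrow> bool" where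
  "is_model M \<longleftrightarrow>
     worlds M \<noteq> {} \<and> agents M \<noteq> {} \<and>
     (\<forall>a \<in> agents M. know M a \<subseteq> worlds M \<times> worlds M) \<and>
     (\<forall>w \<in> worlds M. friend M w \<subseteq> agents M \<times> agents M) \<and>
     (\<forall>x. val M x \<subseteq> worlds M \<times> agents M) \<and>
     (\<forall>n. \<exists>!a. a \<in> agents M \<and> val M (Inr n) = worlds M \<times> {a})"

definition denot :: "('w, 'a, 'p, 'n) model \<Rightarrow> 'n \<Rightarrow> 'a" where
  "denot M n = (THE a. a \<in> agents M \<and> val M (Inr n) = worlds M \<times> {a})"

primrec sat :: "('w, 'a, 'p, 'n) model \<Rightarrow> 'w \<Rightarrow> 'a \<Rightarrow> ('p, 'n) fm \<Rightarrow> bool" where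
  "sat M w a (Nom n) \<longleftrightarrow> denot M n = a"
| "sat M w a (Pro p) \<longleftrightarrow> (w, a) \<in> val M (Inl p)"
| "sat M w a Bot \<longleftrightarrow> False"
| "sat M w a (Imp \<phi> \<psi>) \<longleftrightarrow> (sat M w a \<phi> \<longrightarrow> sat M w a \<psi>)"
| "sat M w a (At n \<phi>) \<longleftrightarrow> sat M w (denot M n) \<phi>"
| "sat M w a (Fr \<phi>) \<longleftrightarrow> (\<forall>b. (a, b) \<in> friend M w \<longrightarrow> sat M w b \<phi>)"
| "sat M w a (Box \<phi>) \<longleftrightarrow> (\<forall>v. (w, v) \<in> know M a \<longrightarrow> sat M v a \<phi>)"


subsection \<open>Tree sequents\<close>

text \<open>\<open>Child \<alpha> n i\<close> is the \<open>n\<close>-child \<open>\<alpha> \<cdot>\<^sub>n i\<close> of \<open>\<alpha>\<close>.\<close>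

datatype (lab_noms: 'n) label = Root nat | Child "'n label" 'n nat

primrec lab_nats :: "'n label \<Rightarrow> nat set" where
  "lab_nats (Root i) = {i}"
| "lab_nats (Child \<alpha> n i) = insert i (lab_nats \<alpha>)"

definition tree :: "'n label set \<Rightarrow> bool" where
  "tree T \<longleftrightarrow> (\<exists>!i. Root i \<in> T) \<and> (\<forall>\<alpha> n i. Child \<alpha> n i \<in> T \<longrightarrow> \<alpha> \<in> T)"

type_synonym ('p, 'n) lfm = "'n label \<times> ('p, 'n) fm"

text \<open>No cardinality restriction is needed for possibly infinite sequents: for countable
  \<open>'p\<close> and \<open>'n\<close> the types of labels and labelled formulas are countable.\<close>

definition tree_sequent ::
    "('p, 'n) lfm set \<Rightarrow> 'n label set \<Rightarrow> ('p, 'n) lfm set \<Rightarrow> bool" where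
  "tree_sequent \<Gamma> T \<Delta> \<longleftrightarrow>
     tree T \<and> (\<forall>(\<alpha>, \<psi>) \<in> \<Gamma> \<union> \<Delta>. \<alpha> \<in> T \<and> at_prefixed \<psi>)"

definition fin_tree_sequent ::
    "('p, 'n) lfm set \<Rightarrow> 'n label set \<Rightarrow> ('p, 'n) lfm set \<Rightarrow> bool" where
  "fin_tree_sequent \<Gamma> T \<Delta> \<longleftrightarrow>
     tree_sequent \<Gamma> T \<Delta> \<and> finite \<Gamma> \<and> finite T \<and> finite \<Delta>"

definition assignment ::
    "('w, 'a, 'p, 'n) model \<Rightarrow> 'n label set \<Rightarrow> ('n label \<Rightarrow> 'w) \<Rightarrow> bool" where
  "assignment M T f \<longleftrightarrow>
     (\<forall>\<alpha> \<in> T. f \<alpha> \<in> worlds M) \<and>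
     (\<forall>\<alpha> n i. \<alpha> \<in> T \<and> Child \<alpha> n i \<in> T \<longrightarrow> (f \<alpha>, f (Child \<alpha> n i)) \<in> know M (denot M n))"

definition sat_lfm ::
    "('w, 'a, 'p, 'n) model \<Rightarrow> ('n label \<Rightarrow> 'w) \<Rightarrow> ('p, 'n) lfm \<Rightarrow> bool" where
  "sat_lfm M f x \<longleftrightarrow> (\<exists>\<alpha> n \<phi>. x = (\<alpha>, At n \<phi>) \<and> sat M (f \<alpha>) (denot M n) \<phi>)"

definition sat_sequent ::
    "('w, 'a, 'p, 'n) model \<Rightarrow> ('n label \<Rightarrow> 'w) \<Rightarrow> ('p, 'n) lfm set \<Rightarrow> ('p, 'n) lfm set \<Rightarrow> bool" where
  "sat_sequent M f \<Gamma> \<Delta> \<longleftrightarrow>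
     ((\<forall>x \<in> \<Gamma>. sat_lfm M f x) \<longrightarrow> (\<exists>x \<in> \<Delta>. sat_lfm M f x))"


subsection \<open>The calculus\<close>

text \<open>A nominal can also occur in a sequent inside a label of its tree; freshness for the
  rule \<open>FR\<close> has to exclude this.\<close>

definition seq_noms ::
    "('p, 'n) lfm set \<Rightarrow> 'n label set \<Rightarrow> ('p, 'n) lfm set \<Rightarrow> 'n set" where
  "seq_noms \<Gamma> T \<Delta> = (\<Union>(\<alpha>, \<psi>) \<in> \<Gamma> \<union> \<Delta>. lab_noms \<alpha> \<union> noms \<psi>) \<union> (\<Union>\<alpha> \<in> T. lab_noms \<alpha>)"

definition seq_nats ::
    "('p, 'n) lfm set \<Rightarrow> 'n label set \<Rightarrow> ('p, 'n) lfm set \<Rightarrow> nat set" where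
  "seq_nats \<Gamma> T \<Delta> = (\<Union>(\<alpha>, \<psi>) \<in> \<Gamma> \<union> \<Delta>. lab_nats \<alpha>) \<union> (\<Union>\<alpha> \<in> T. lab_nats \<alpha>)"

text \<open>Each rule requires its conclusion to be a finite tree sequent; for its premises this
  follows by induction. This also guarantees that the labels \<open>\<alpha>\<close> and \<open>\<beta>\<close> belong to \<open>T\<close>.\<close>

inductive derivable ::
    "('p, 'n) lfm set \<Rightarrow> 'n label set \<Rightarrow> ('p, 'n) lfm set \<Rightarrow> bool" where
  init_bot:
  "fin_tree_sequent (insert (\<alpha>, At n Bot) \<Gamma>) T \<Delta> \<Longrightarrow>
   derivable (insert (\<alpha>, At n Bot) \<Gamma>) T \<Delta>"
| init_id:
  "fin_tree_sequent (insert (\<alpha>, At n \<phi>) \<Gamma>) T (insert (\<alpha>, At n \<phi>) \<Delta>) \<Longrightarrow>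
   derivable (insert (\<alpha>, At n \<phi>) \<Gamma>) T (insert (\<alpha>, At n \<phi>) \<Delta>)"
| rep1:
  "derivable (insert (\<alpha>, At n (Nom m)) (insert (\<alpha>, subst \<phi> n k) \<Gamma>)) T \<Delta> \<Longrightarrow>
   fin_tree_sequent (insert (\<alpha>, At n (Nom m)) (insert (\<alpha>, subst \<phi> m k) \<Gamma>)) T \<Delta> \<Longrightarrow>
   derivable (insert (\<alpha>, At n (Nom m)) (insert (\<alpha>, subst \<phi> m k) \<Gamma>)) T \<Delta>"
| rep2:
  "derivable (insert (\<alpha>, At n (Nom m)) (insert (\<alpha>, subst \<phi> m k) \<Gamma>)) T \<Delta> \<Longrightarrow>
   fin_tree_sequent (insert (\<alpha>, At n (Nom m)) (insert (\<alpha>, subst \<phi> n k) \<Gamma>)) T \<Delta> \<Longrightarrow>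
   derivable (insert (\<alpha>, At n (Nom m)) (insert (\<alpha>, subst \<phi> n k) \<Gamma>)) T \<Delta>"
| ref:
  "derivable (insert (\<alpha>, At n (Nom n)) \<Gamma>) T \<Delta> \<Longrightarrow>
   fin_tree_sequent \<Gamma> T \<Delta> \<Longrightarrow>
   derivable \<Gamma> T \<Delta>"
| rigid:
  "derivable (insert (\<beta>, At n (Nom m)) \<Gamma>) T \<Delta> \<Longrightarrow>
   fin_tree_sequent (insert (\<alpha>, At n (Nom m)) \<Gamma>) T \<Delta> \<Longrightarrow>
   derivable (insert (\<alpha>, At n (Nom m)) \<Gamma>) T \<Delta>"
| ImpR:
  "derivable (insert (\<alpha>, At n \<phi>) \<Gamma>) T (insert (\<alpha>, At n \<psi>) \<Delta>) \<Longrightarrow>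
   fin_tree_sequent \<Gamma> T (insert (\<alpha>, At n (Imp \<phi> \<psi>)) \<Delta>) \<Longrightarrow>
   derivable \<Gamma> T (insert (\<alpha>, At n (Imp \<phi> \<psi>)) \<Delta>)"
| ImpL:
  "derivable \<Gamma> T (insert (\<alpha>, At n \<phi>) \<Delta>) \<Longrightarrow>
   derivable (insert (\<alpha>, At n \<psi>) \<Gamma>) T \<Delta> \<Longrightarrow>
   fin_tree_sequent (insert (\<alpha>, At n (Imp \<phi> \<psi>)) \<Gamma>) T \<Delta> \<Longrightarrow>
   derivable (insert (\<alpha>, At n (Imp \<phi> \<psi>)) \<Gamma>) T \<Delta>"
| AtR:
  "derivable \<Gamma> T (insert (\<alpha>, At m \<phi>) \<Delta>) \<Longrightarrow>
   fin_tree_sequent \<Gamma> T (insert (\<alpha>, At n (At m \<phi>)) \<Delta>) \<Longrightarrow>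
   derivable \<Gamma> T (insert (\<alpha>, At n (At m \<phi>)) \<Delta>)"
| AtL:
  "derivable (insert (\<alpha>, At m \<phi>) \<Gamma>) T \<Delta> \<Longrightarrow>
   fin_tree_sequent (insert (\<alpha>, At n (At m \<phi>)) \<Gamma>) T \<Delta> \<Longrightarrow>
   derivable (insert (\<alpha>, At n (At m \<phi>)) \<Gamma>) T \<Delta>"
| FR:
  "derivable (insert (\<alpha>, At n (DiaF (Nom m))) \<Gamma>) T (insert (\<alpha>, At m \<phi>) \<Delta>) \<Longrightarrow>
   m \<notin> seq_noms \<Gamma> T (insert (\<alpha>, At n (Fr \<phi>)) \<Delta>) \<Longrightarrow>
   fin_tree_sequent \<Gamma> T (insert (\<alpha>, At n (Fr \<phi>)) \<Delta>) \<Longrightarrow>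
   derivable \<Gamma> T (insert (\<alpha>, At n (Fr \<phi>)) \<Delta>)"
| FL:
  "derivable \<Gamma> T (insert (\<alpha>, At n (DiaF (Nom m))) \<Delta>) \<Longrightarrow>
   derivable (insert (\<alpha>, At m \<phi>) \<Gamma>) T \<Delta> \<Longrightarrow>
   fin_tree_sequent (insert (\<alpha>, At n (Fr \<phi>)) \<Gamma>) T \<Delta> \<Longrightarrow>
   derivable (insert (\<alpha>, At n (Fr \<phi>)) \<Gamma>) T \<Delta>"
| BoxR:
  "derivable \<Gamma> (insert (Child \<alpha> n i) T) (insert (Child \<alpha> n i, At n \<phi>) \<Delta>) \<Longrightarrow>
   i \<notin> seq_nats \<Gamma> T (insert (\<alpha>, At n (Box \<phi>)) \<Delta>) \<Longrightarrow>
   fin_tree_sequent \<Gamma> T (insert (\<alpha>, At n (Box \<phi>)) \<Delta>) \<Longrightarrow>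
   derivable \<Gamma> T (insert (\<alpha>, At n (Box \<phi>)) \<Delta>)"
| BoxL:
  "derivable (insert (\<beta>, At n \<phi>) \<Gamma>) T \<Delta> \<Longrightarrow>
   \<beta> = Child \<alpha> n i \<Longrightarrow>
   fin_tree_sequent (insert (\<alpha>, At n (Box \<phi>)) \<Gamma>) T \<Delta> \<Longrightarrow>
   derivable (insert (\<alpha>, At n (Box \<phi>)) \<Gamma>) T \<Delta>"
| wlab:
  "derivable \<Gamma> T \<Delta> \<Longrightarrow>
   fin_tree_sequent \<Gamma> (insert \<alpha> T) \<Delta> \<Longrightarrow>
   derivable \<Gamma> (insert \<alpha> T) \<Delta>"

definition provable ::
    "('p, 'n) lfm set \<Rightarrow> 'n label set \<Rightarrow> ('p, 'n) lfm set \<Rightarrow> bool" where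
  "provable \<Gamma> T \<Delta> \<longleftrightarrow>
     (\<exists>\<Gamma>' T' \<Delta>'. \<Gamma>' \<subseteq> \<Gamma> \<and> finite \<Gamma>' \<and> T' \<subseteq> T \<and> finite T' \<and> tree T' \<and>
        \<Delta>' \<subseteq> \<Delta> \<and> finite \<Delta>' \<and> derivable \<Gamma>' T' \<Delta>')"

end

theory Submission
  imports Defs
begin

text \<open>An unprovable sequent is extended to a maximal unprovable one that has witnesses for the
  \<open>F\<close>- and \<open>\<box>\<close>-formulas on its right-hand side; its labels and its nominals modulo the equations
  on the left are the worlds and agents of a countermodel. Maximality is stated for both sides
  separately: without cut a formula may be on neither side, so the truth lemma
  only concerns formulas that do occur. The given sequent may already use all nominals and all
  numbers, so it is first renamed into a larger language, where infinitely many of both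
  remain fresh. Derivations are stable under arbitrary renamings, so one can go back by a left
  inverse, and every model of the larger language has a reduct.\<close>

text \<open>Three obstacles shape the proof. Provability of an infinite sequent speaks of some
  finite part, and different premises of a rule may come with different parts. Merging them needs
  weakening, but the calculus weakens only the tree; weakening for formulas is obtained as the case
  of the identity in the renaming lemma. Maximality alone yields closure under the rules without
  freshness conditions. It cannot yield witnesses: a maximal sequent contains every
  \<open>At n (Nom n)\<close> on the left, so no nominal is fresh for it. Finally, the missing cut
  threatens the case of \<open>Fr\<close>, where friendship should match the truth of the compound
  formula \<open>DiaF (Nom m)\<close>. Friendship is instead read off the occurrences of
  \<open>DiaF (Nom m)\<close> on the left. The left premise of \<open>FL\<close> has just this
  formula on the right, so disjointness of the two sides is all that is required.\<close>

section \<open>Renaming of nominals and of the numbers in labels\<close>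

primrec relab :: "('n \<Rightarrow> 'm) \<Rightarrow> (nat \<Rightarrow> nat) \<Rightarrow> 'n label \<Rightarrow> 'm label" where
  "relab \<sigma> \<tau> (Root i) = Root (\<tau> i)"
| "relab \<sigma> \<tau> (Child \<alpha> n i) = Child (relab \<sigma> \<tau> \<alpha>) (\<sigma> n) (\<tau> i)"

definition relfm :: "('n \<Rightarrow> 'm) \<Rightarrow> (nat \<Rightarrow> nat) \<Rightarrow> ('p, 'n) lfm \<Rightarrow> ('p, 'm) lfm" where
  "relfm \<sigma> \<tau> x = (relab \<sigma> \<tau> (fst x), map_fm id \<sigma> (snd x))"

lemma relfm_Pair [simp]: "relfm \<sigma> \<tau> (\<alpha>, \<psi>) = (relab \<sigma> \<tau> \<alpha>, map_fm id \<sigma> \<psi>)"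
  by (simp add: relfm_def)

lemma relab_cong:
  "(\<And>n. n \<in> lab_noms \<alpha> \<Longrightarrow> \<sigma> n = \<sigma>' n) \<Longrightarrow> (\<And>i. i \<in> lab_nats \<alpha> \<Longrightarrow> \<tau> i = \<tau>' i) \<Longrightarrow>
   relab \<sigma> \<tau> \<alpha> = relab \<sigma>' \<tau>' \<alpha>"
  by (induction \<alpha>) auto

lemma relab_relab: "relab \<sigma>' \<tau>' (relab \<sigma> \<tau> \<alpha>) = relab (\<sigma>' \<circ> \<sigma>) (\<tau>' \<circ> \<tau>) \<alpha>"
  by (induction \<alpha>) auto

lemma relab_id [simp]: "relab id id = id"
proof
  show "relab id id \<alpha> = id \<alpha>" for \<alpha> :: "'a label"
    by (induction \<alpha>) auto
qed

lemma relfm_relfm: "relfm \<sigma>' \<tau>' (relfm \<sigma> \<tau> x) = relfm (\<sigma>' \<circ> \<sigma>) (\<tau>' \<circ> \<tau>) x"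
  by (simp add: relfm_def relab_relab fm.map_comp)

lemma relfm_id [simp]: "relfm id id = id"
  by (simp add: relfm_def fm.map_id0 fun_eq_iff)

lemma relfm_cong:
  "(\<And>n. n \<in> lab_noms (fst x) \<union> noms (snd x) \<Longrightarrow> \<sigma> n = \<sigma>' n) \<Longrightarrow>
   (\<And>i. i \<in> lab_nats (fst x) \<Longrightarrow> \<tau> i = \<tau>' i) \<Longrightarrow> relfm \<sigma> \<tau> x = relfm \<sigma>' \<tau>' x"
  by (auto simp: relfm_def intro!: relab_cong fm.map_cong)

lemma map_fm_DiaF [simp]: "map_fm f \<sigma> (DiaF \<phi>) = DiaF (map_fm f \<sigma> \<phi>)"
  by (simp add: DiaF_def Neg_def)

lemma at_prefixed_At [simp]: "at_prefixed (At n \<phi>)"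
  by (simp add: at_prefixed_def)

lemma at_prefixed_map_fm [simp]: "at_prefixed (map_fm f \<sigma> \<psi>) = at_prefixed \<psi>"
  by (cases \<psi>) (auto simp: at_prefixed_def)

lemma at_prefixed_subst [simp]: "at_prefixed (subst \<psi> m k) = at_prefixed \<psi>"
  by (simp add: subst_def)

lemma finite_noms [simp]: "finite (noms \<phi>)"
  by (induction \<phi>) auto

lemma finite_lab_noms [simp]: "finite (lab_noms \<alpha>)"
  by (induction \<alpha>) auto

lemma finite_lab_nats [simp]: "finite (lab_nats \<alpha>)"
  by (induction \<alpha>) auto

text \<open>A non-injective \<open>\<sigma>\<close> may identify \<open>k\<close> with other nominals of \<open>\<phi>\<close>, so \<open>k\<close> is first
  renamed apart.\<close>

lemma map_fm_subst:
  assumes "k' \<notin> \<sigma> ` noms \<phi>"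
  shows "map_fm id \<sigma> (subst \<phi> n k) = subst (map_fm id (\<sigma>(k := k')) \<phi>) (\<sigma> n) k'"
  unfolding subst_def fm.map_comp using assms by (intro fm.map_cong) auto

section \<open>Well-formed sequents and the symbols occurring in them\<close>

lemma tree_sequent_insert_left [simp]:
  "tree_sequent (insert x \<Gamma>) T \<Delta> \<longleftrightarrow> fst x \<in> T \<and> at_prefixed (snd x) \<and> tree_sequent \<Gamma> T \<Delta>"
  by (auto simp: tree_sequent_def)

lemma tree_sequent_insert_right [simp]:
  "tree_sequent \<Gamma> T (insert x \<Delta>) \<longleftrightarrow> fst x \<in> T \<and> at_prefixed (snd x) \<and> tree_sequent \<Gamma> T \<Delta>"
  by (auto simp: tree_sequent_def)

lemma fin_tree_sequent_insert_left [simp]: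
  "fin_tree_sequent (insert x \<Gamma>) T \<Delta> \<longleftrightarrow> fst x \<in> T \<and> at_prefixed (snd x) \<and> fin_tree_sequent \<Gamma> T \<Delta>"
  by (auto simp: fin_tree_sequent_def)

lemma fin_tree_sequent_insert_right [simp]:
  "fin_tree_sequent \<Gamma> T (insert x \<Delta>) \<longleftrightarrow> fst x \<in> T \<and> at_prefixed (snd x) \<and> fin_tree_sequent \<Gamma> T \<Delta>"
  by (auto simp: fin_tree_sequent_def)

lemma tree_insert_Child: "tree T \<Longrightarrow> \<alpha> \<in> T \<Longrightarrow> tree (insert (Child \<alpha> n i) T)"
  by (auto simp: tree_def)

lemma tree_sequent_insert_Child:
  "tree_sequent \<Gamma> T \<Delta> \<Longrightarrow> \<alpha> \<in> T \<Longrightarrow> tree_sequent \<Gamma> (insert (Child \<alpha> n i) T) \<Delta>"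
  by (auto simp: tree_sequent_def tree_insert_Child)

lemma fin_tree_sequent_insert_Child:
  "fin_tree_sequent \<Gamma> T \<Delta> \<Longrightarrow> \<alpha> \<in> T \<Longrightarrow> fin_tree_sequent \<Gamma> (insert (Child \<alpha> n i) T) \<Delta>"
  by (auto simp: fin_tree_sequent_def tree_sequent_insert_Child)

lemma tree_sequent_memD:
  assumes "tree_sequent \<Gamma> T \<Delta>"
  shows "(\<alpha>, \<psi>) \<in> \<Gamma> \<Longrightarrow> \<alpha> \<in> T \<and> at_prefixed \<psi>" "(\<alpha>, \<psi>) \<in> \<Delta> \<Longrightarrow> \<alpha> \<in> T \<and> at_prefixed \<psi>"
  using assms by (auto simp: tree_sequent_def)

lemma fin_tree_sequent_memD:
  assumes "fin_tree_sequent \<Gamma> T \<Delta>"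
  shows "(\<alpha>, \<psi>) \<in> \<Gamma> \<Longrightarrow> \<alpha> \<in> T \<and> at_prefixed \<psi>" "(\<alpha>, \<psi>) \<in> \<Delta> \<Longrightarrow> \<alpha> \<in> T \<and> at_prefixed \<psi>"
  using assms by (auto simp: fin_tree_sequent_def dest: tree_sequent_memD)

lemma seq_noms_memD:
  assumes "m \<notin> seq_noms \<Gamma> T \<Delta>"
  shows "x \<in> \<Gamma> \<Longrightarrow> m \<notin> lab_noms (fst x) \<union> noms (snd x)"
    "x \<in> \<Delta> \<Longrightarrow> m \<notin> lab_noms (fst x) \<union> noms (snd x)" "\<alpha> \<in> T \<Longrightarrow> m \<notin> lab_noms \<alpha>"
  using assms by (force simp: seq_noms_def)+

lemma seq_nats_memD:
  assumes "i \<notin> seq_nats \<Gamma> T \<Delta>"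
  shows "x \<in> \<Gamma> \<Longrightarrow> i \<notin> lab_nats (fst x)" "x \<in> \<Delta> \<Longrightarrow> i \<notin> lab_nats (fst x)"
    "\<alpha> \<in> T \<Longrightarrow> i \<notin> lab_nats \<alpha>"
  using assms by (force simp: seq_nats_def)+

lemma seq_noms_mono:
  "\<Gamma> \<subseteq> \<Gamma>' \<Longrightarrow> T \<subseteq> T' \<Longrightarrow> \<Delta> \<subseteq> \<Delta>' \<Longrightarrow> seq_noms \<Gamma> T \<Delta> \<subseteq> seq_noms \<Gamma>' T' \<Delta>'"
  unfolding seq_noms_def by (intro Un_mono UN_mono) auto

lemma seq_nats_mono:
  "\<Gamma> \<subseteq> \<Gamma>' \<Longrightarrow> T \<subseteq> T' \<Longrightarrow> \<Delta> \<subseteq> \<Delta>' \<Longrightarrow> seq_nats \<Gamma> T \<Delta> \<subseteq> seq_nats \<Gamma>' T' \<Delta>'"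
  unfolding seq_nats_def by (intro Un_mono UN_mono) auto

lemma finite_seq_noms: "fin_tree_sequent \<Gamma> T \<Delta> \<Longrightarrow> finite (seq_noms \<Gamma> T \<Delta>)"
  by (auto simp: fin_tree_sequent_def seq_noms_def)

lemma finite_seq_nats: "fin_tree_sequent \<Gamma> T \<Delta> \<Longrightarrow> finite (seq_nats \<Gamma> T \<Delta>)"
  by (auto simp: fin_tree_sequent_def seq_nats_def)

lemma derivable_fin_tree_sequent: "derivable \<Gamma> T \<Delta> \<Longrightarrow> fin_tree_sequent \<Gamma> T \<Delta>"
  by (induction rule: derivable.induct) simp_all

section \<open>The rules with principal formulas given by membership\<close>

context
  fixes \<Gamma> \<Delta> :: "('p, 'n) lfm set" and T :: "'n label set"
  assumes fin: "fin_tree_sequent \<Gamma> T \<Delta>"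
begin

lemma derivable_init_bot: "(\<alpha>, At n Bot) \<in> \<Gamma> \<Longrightarrow> derivable \<Gamma> T \<Delta>"
  using init_bot fin by (metis insert_absorb)

lemma derivable_init_id: "(\<alpha>, At n \<phi>) \<in> \<Gamma> \<Longrightarrow> (\<alpha>, At n \<phi>) \<in> \<Delta> \<Longrightarrow> derivable \<Gamma> T \<Delta>"
  using init_id fin by (metis insert_absorb)

text \<open>Sequents are sets, so \<open>insert\<close> absorbs a principal formula that is already
  present, and the premise may keep it. Contraction is thus built into this form of the rules, here
  and in the rest of the context.\<close>

lemma derivable_rep1:
  assumes "(\<alpha>, At n (Nom m)) \<in> \<Gamma>" "(\<alpha>, subst \<phi> m k) \<in> \<Gamma>"
    and "derivable (insert (\<alpha>, subst \<phi> n k) \<Gamma>) T \<Delta>"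
  shows "derivable \<Gamma> T \<Delta>"
  using rep1[of \<alpha> n m \<phi> k \<Gamma> T \<Delta>] assms fin by (simp add: insert_absorb insert_commute)

lemma derivable_rep2:
  assumes "(\<alpha>, At n (Nom m)) \<in> \<Gamma>" "(\<alpha>, subst \<phi> n k) \<in> \<Gamma>"
    and "derivable (insert (\<alpha>, subst \<phi> m k) \<Gamma>) T \<Delta>"
  shows "derivable \<Gamma> T \<Delta>"
  using rep2[of \<alpha> n m \<phi> k \<Gamma> T \<Delta>] assms fin by (simp add: insert_absorb insert_commute)

lemma derivable_ref: "derivable (insert (\<alpha>, At n (Nom n)) \<Gamma>) T \<Delta> \<Longrightarrow> derivable \<Gamma> T \<Delta>"
  using ref fin by metis

lemma derivable_rigid:
  "(\<alpha>, At n (Nom m)) \<in> \<Gamma> \<Longrightarrow> derivable (insert (\<beta>, At n (Nom m)) \<Gamma>) T \<Delta> \<Longrightarrow> derivable \<Gamma> T \<Delta>"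
  using rigid fin by (metis insert_absorb)

lemma derivable_ImpR:
  "(\<alpha>, At n (Imp \<phi> \<psi>)) \<in> \<Delta> \<Longrightarrow>
   derivable (insert (\<alpha>, At n \<phi>) \<Gamma>) T (insert (\<alpha>, At n \<psi>) \<Delta>) \<Longrightarrow> derivable \<Gamma> T \<Delta>"
  using ImpR[of \<alpha> n \<phi> \<Gamma> T \<psi> \<Delta>] fin by (simp add: insert_absorb)

lemma derivable_ImpL:
  "(\<alpha>, At n (Imp \<phi> \<psi>)) \<in> \<Gamma> \<Longrightarrow> derivable \<Gamma> T (insert (\<alpha>, At n \<phi>) \<Delta>) \<Longrightarrow>
   derivable (insert (\<alpha>, At n \<psi>) \<Gamma>) T \<Delta> \<Longrightarrow> derivable \<Gamma> T \<Delta>"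
  using ImpL[of \<Gamma> T \<alpha> n \<phi> \<Delta> \<psi>] fin by (simp add: insert_absorb)

lemma derivable_AtR:
  "(\<alpha>, At n (At m \<phi>)) \<in> \<Delta> \<Longrightarrow> derivable \<Gamma> T (insert (\<alpha>, At m \<phi>) \<Delta>) \<Longrightarrow> derivable \<Gamma> T \<Delta>"
  using AtR[of \<Gamma> T \<alpha> m \<phi> \<Delta> n] fin by (simp add: insert_absorb)

lemma derivable_AtL:
  "(\<alpha>, At n (At m \<phi>)) \<in> \<Gamma> \<Longrightarrow> derivable (insert (\<alpha>, At m \<phi>) \<Gamma>) T \<Delta> \<Longrightarrow> derivable \<Gamma> T \<Delta>"
  using AtL[of \<alpha> m \<phi> \<Gamma> T \<Delta> n] fin by (simp add: insert_absorb)

lemma derivable_FR: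
  "(\<alpha>, At n (Fr \<phi>)) \<in> \<Delta> \<Longrightarrow> m \<notin> seq_noms \<Gamma> T \<Delta> \<Longrightarrow>
   derivable (insert (\<alpha>, At n (DiaF (Nom m))) \<Gamma>) T (insert (\<alpha>, At m \<phi>) \<Delta>) \<Longrightarrow> derivable \<Gamma> T \<Delta>"
  using FR[of \<alpha> n m \<Gamma> T \<phi> \<Delta>] fin by (simp add: insert_absorb)

lemma derivable_FL:
  "(\<alpha>, At n (Fr \<phi>)) \<in> \<Gamma> \<Longrightarrow> derivable \<Gamma> T (insert (\<alpha>, At n (DiaF (Nom m))) \<Delta>) \<Longrightarrow>
   derivable (insert (\<alpha>, At m \<phi>) \<Gamma>) T \<Delta> \<Longrightarrow> derivable \<Gamma> T \<Delta>"
  using FL[of \<Gamma> T \<alpha> n m \<Delta> \<phi>] fin by (simp add: insert_absorb)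

lemma derivable_BoxR:
  "(\<alpha>, At n (Box \<phi>)) \<in> \<Delta> \<Longrightarrow> i \<notin> seq_nats \<Gamma> T \<Delta> \<Longrightarrow>
   derivable \<Gamma> (insert (Child \<alpha> n i) T) (insert (Child \<alpha> n i, At n \<phi>) \<Delta>) \<Longrightarrow> derivable \<Gamma> T \<Delta>"
  using BoxR[of \<Gamma> \<alpha> n i T \<phi> \<Delta>] fin by (simp add: insert_absorb)

lemma derivable_BoxL:
  "(\<alpha>, At n (Box \<phi>)) \<in> \<Gamma> \<Longrightarrow> derivable (insert (Child \<alpha> n i, At n \<phi>) \<Gamma>) T \<Delta> \<Longrightarrow>
   derivable \<Gamma> T \<Delta>"
  using BoxL[of _ n \<phi> \<Gamma> T \<Delta> \<alpha> i, OF _ refl] fin by (simp add: insert_absorb)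

end

section \<open>Admissibility of renaming and weakening\<close>

text \<open>Renaming and weakening are proved together because both endanger fresh symbols in the
  same way: the image of a fresh symbol may occur in the target. With the renaming and the target
  arbitrary in the induction, each fresh symbol can be redirected to one that is fresh for the whole
  finite target.\<close>

lemma derivable_rename:
  fixes \<sigma> :: "'n \<Rightarrow> 'm::infinite" and \<Gamma> \<Delta> :: "('p, 'n) lfm set"
  assumes "derivable \<Gamma> T \<Delta>"
    and "relfm \<sigma> \<tau> ` \<Gamma> \<subseteq> \<Gamma>'" "relab \<sigma> \<tau> ` T \<subseteq> T'" "relfm \<sigma> \<tau> ` \<Delta> \<subseteq> \<Delta>'"
    and "fin_tree_sequent \<Gamma>' T' \<Delta>'"
  shows "derivable \<Gamma>' T' \<Delta>'"
  using assms
proof (induction arbitrary: \<sigma> \<tau> \<Gamma>' T' \<Delta>' rule: derivable.induct)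
  case (init_bot \<alpha> n \<Gamma> T \<Delta>)
  then show ?case by (auto intro: derivable_init_bot)
next
  case (init_id \<alpha> n \<phi> \<Gamma> T \<Delta>)
  then show ?case by (auto intro: derivable_init_id)
next
  case (rep1 \<alpha> n m \<phi> k \<Gamma> T \<Delta>)
  note fin = \<open>fin_tree_sequent \<Gamma>' T' \<Delta>'\<close>
  obtain k' where k': "k' \<notin> \<sigma> ` noms \<phi>"
    using ex_new_if_finite[OF infinite_UNIV] finite_noms finite_imageI by metis
  let ?\<phi> = "map_fm id (\<sigma>(k := k')) \<phi>"
  have m: "(relab \<sigma> \<tau> \<alpha>, At (\<sigma> n) (Nom (\<sigma> m))) \<in> \<Gamma>'" "(relab \<sigma> \<tau> \<alpha>, subst ?\<phi> (\<sigma> m) k') \<in> \<Gamma>'"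
    using rep1.prems(1) by (auto simp flip: map_fm_subst[OF k'])
  have "derivable (insert (relab \<sigma> \<tau> \<alpha>, subst ?\<phi> (\<sigma> n) k') \<Gamma>') T' \<Delta>'"
    using rep1.prems fin_tree_sequent_memD(1)[OF fin m(1)] fin_tree_sequent_memD(1)[OF fin m(2)]
    by (intro rep1.IH[of \<sigma> \<tau>]) (auto simp flip: map_fm_subst[OF k'])
  with m show ?case by (rule derivable_rep1[OF fin])
next
  case (rep2 \<alpha> n m \<phi> k \<Gamma> T \<Delta>)
  note fin = \<open>fin_tree_sequent \<Gamma>' T' \<Delta>'\<close>
  obtain k' where k': "k' \<notin> \<sigma> ` noms \<phi>"
    using ex_new_if_finite[OF infinite_UNIV] finite_noms finite_imageI by metis
  let ?\<phi> = "map_fm id (\<sigma>(k := k')) \<phi>"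
  have m: "(relab \<sigma> \<tau> \<alpha>, At (\<sigma> n) (Nom (\<sigma> m))) \<in> \<Gamma>'" "(relab \<sigma> \<tau> \<alpha>, subst ?\<phi> (\<sigma> n) k') \<in> \<Gamma>'"
    using rep2.prems(1) by (auto simp flip: map_fm_subst[OF k'])
  have "derivable (insert (relab \<sigma> \<tau> \<alpha>, subst ?\<phi> (\<sigma> m) k') \<Gamma>') T' \<Delta>'"
    using rep2.prems fin_tree_sequent_memD(1)[OF fin m(1)] fin_tree_sequent_memD(1)[OF fin m(2)]
    by (intro rep2.IH[of \<sigma> \<tau>]) (auto simp flip: map_fm_subst[OF k'])
  with m show ?case by (rule derivable_rep2[OF fin])
next
  case (ref \<alpha> n \<Gamma> T \<Delta>)
  have "relab \<sigma> \<tau> \<alpha> \<in> T'"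
    using derivable_fin_tree_sequent[OF ref.hyps(1)] ref.prems by auto
  then have "derivable (insert (relab \<sigma> \<tau> \<alpha>, At (\<sigma> n) (Nom (\<sigma> n))) \<Gamma>') T' \<Delta>'"
    using ref.prems by (intro ref.IH[of \<sigma> \<tau>]) auto
  then show ?case by (rule derivable_ref[OF ref.prems(4)])
next
  case (rigid \<beta> n m \<Gamma> T \<Delta> \<alpha>)
  have "relab \<sigma> \<tau> \<beta> \<in> T'"
    using derivable_fin_tree_sequent[OF rigid.hyps(1)] rigid.prems by auto
  then have "derivable (insert (relab \<sigma> \<tau> \<beta>, At (\<sigma> n) (Nom (\<sigma> m))) \<Gamma>') T' \<Delta>'"
    using rigid.prems by (intro rigid.IH[of \<sigma> \<tau>]) auto
  then show ?case using rigid.prems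
    by (auto intro: derivable_rigid[of _ _ _ "relab \<sigma> \<tau> \<alpha>" "\<sigma> n" "\<sigma> m"])
next
  case (ImpR \<alpha> n \<phi> \<Gamma> T \<psi> \<Delta>)
  have "derivable (insert (relab \<sigma> \<tau> \<alpha>, At (\<sigma> n) (map_fm id \<sigma> \<phi>)) \<Gamma>') T'
     (insert (relab \<sigma> \<tau> \<alpha>, At (\<sigma> n) (map_fm id \<sigma> \<psi>)) \<Delta>')"
    using ImpR.prems fin_tree_sequent_memD[OF ImpR.prems(4)]
    by (intro ImpR.IH[of \<sigma> \<tau>]) auto
  with ImpR.prems show ?case
    by (rule_tac derivable_ImpR[of _ _ _ "relab \<sigma> \<tau> \<alpha>" "\<sigma> n"]) auto
next
  case (ImpL \<Gamma> T \<alpha> n \<phi> \<Delta> \<psi>)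
  have "derivable \<Gamma>' T' (insert (relab \<sigma> \<tau> \<alpha>, At (\<sigma> n) (map_fm id \<sigma> \<phi>)) \<Delta>')"
    using ImpL.prems fin_tree_sequent_memD[OF ImpL.prems(4)]
    by (intro ImpL.IH(1)[of \<sigma> \<tau>]) auto
  moreover have "derivable (insert (relab \<sigma> \<tau> \<alpha>, At (\<sigma> n) (map_fm id \<sigma> \<psi>)) \<Gamma>') T' \<Delta>'"
    using ImpL.prems fin_tree_sequent_memD[OF ImpL.prems(4)]
    by (intro ImpL.IH(2)[of \<sigma> \<tau>]) auto
  ultimately show ?case using ImpL.prems
    by (rule_tac derivable_ImpL[of _ _ _ "relab \<sigma> \<tau> \<alpha>" "\<sigma> n" "map_fm id \<sigma> \<phi>" "map_fm id \<sigma> \<psi>"]) auto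
next
  case (AtR \<Gamma> T \<alpha> m \<phi> \<Delta> n)
  have "derivable \<Gamma>' T' (insert (relab \<sigma> \<tau> \<alpha>, At (\<sigma> m) (map_fm id \<sigma> \<phi>)) \<Delta>')"
    using AtR.prems fin_tree_sequent_memD[OF AtR.prems(4)]
    by (intro AtR.IH[of \<sigma> \<tau>]) auto
  with AtR.prems show ?case
    by (rule_tac derivable_AtR[of _ _ _ "relab \<sigma> \<tau> \<alpha>" "\<sigma> n"]) auto
next
  case (AtL \<alpha> m \<phi> \<Gamma> T \<Delta> n)
  have "derivable (insert (relab \<sigma> \<tau> \<alpha>, At (\<sigma> m) (map_fm id \<sigma> \<phi>)) \<Gamma>') T' \<Delta>'"
    using AtL.prems fin_tree_sequent_memD[OF AtL.prems(4)]
    by (intro AtL.IH[of \<sigma> \<tau>]) auto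
  with AtL.prems show ?case
    by (rule_tac derivable_AtL[of _ _ _ "relab \<sigma> \<tau> \<alpha>" "\<sigma> n"]) auto
next
  case (FR \<alpha> n m \<Gamma> T \<phi> \<Delta>)
  note fin = \<open>fin_tree_sequent \<Gamma>' T' \<Delta>'\<close> and fresh = seq_noms_memD[OF FR.hyps(2)]
  obtain m' where m': "m' \<notin> seq_noms \<Gamma>' T' \<Delta>'"
    using ex_new_if_finite[OF infinite_UNIV finite_seq_noms[OF fin]] by blast
  \<comment> \<open>Since \<open>m\<close> does not occur in the conclusion, changing
    \<open>\<sigma>\<close> at \<open>m\<close> leaves the image of the conclusion as it was.
    \<open>BoxR\<close> is treated alike, with \<open>\<tau>\<close> in place of
    \<open>\<sigma>\<close>.\<close>
  let ?\<sigma> = "\<sigma>(m := m')"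
  have fm: "relfm ?\<sigma> \<tau> x = relfm \<sigma> \<tau> x" if "x \<in> \<Gamma> \<union> insert (\<alpha>, At n (Fr \<phi>)) \<Delta>" for x
    using fresh(1,2)[of x] that by (intro relfm_cong) auto
  have lab: "relab ?\<sigma> \<tau> \<beta> = relab \<sigma> \<tau> \<beta>" if "\<beta> \<in> T" for \<beta>
    using fresh(3)[OF that] by (intro relab_cong) auto
  have prems: "relfm ?\<sigma> \<tau> ` \<Gamma> \<subseteq> \<Gamma>'" "relab ?\<sigma> \<tau> ` T \<subseteq> T'"
    "relfm ?\<sigma> \<tau> ` (insert (\<alpha>, At n (Fr \<phi>)) \<Delta>) \<subseteq> \<Delta>'"
    using FR.prems fm lab by (auto simp del: relfm_Pair simp: image_subset_iff)
  have "derivable (insert (relab ?\<sigma> \<tau> \<alpha>, At (?\<sigma> n) (DiaF (Nom m'))) \<Gamma>') T'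
     (insert (relab ?\<sigma> \<tau> \<alpha>, At m' (map_fm id ?\<sigma> \<phi>)) \<Delta>')"
    using prems fin_tree_sequent_memD[OF fin] fin
    by (intro FR.IH[of ?\<sigma> \<tau>]) (auto simp del: fun_upd_apply simp: fun_upd_same)
  with prems m' show ?case
    by (rule_tac derivable_FR[OF fin, of "relab ?\<sigma> \<tau> \<alpha>" "?\<sigma> n"]) (auto simp del: fun_upd_apply)
next
  case (FL \<Gamma> T \<alpha> n m \<Delta> \<phi>)
  have "derivable \<Gamma>' T' (insert (relab \<sigma> \<tau> \<alpha>, At (\<sigma> n) (DiaF (Nom (\<sigma> m)))) \<Delta>')"
    using FL.prems fin_tree_sequent_memD[OF FL.prems(4)]
    by (intro FL.IH(1)[of \<sigma> \<tau>]) auto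
  moreover have "derivable (insert (relab \<sigma> \<tau> \<alpha>, At (\<sigma> m) (map_fm id \<sigma> \<phi>)) \<Gamma>') T' \<Delta>'"
    using FL.prems fin_tree_sequent_memD[OF FL.prems(4)]
    by (intro FL.IH(2)[of \<sigma> \<tau>]) auto
  ultimately show ?case using FL.prems
    by (rule_tac derivable_FL[of _ _ _ "relab \<sigma> \<tau> \<alpha>" "\<sigma> n" "map_fm id \<sigma> \<phi>" "\<sigma> m"]) auto
next
  case (BoxR \<Gamma> \<alpha> n i T \<phi> \<Delta>)
  note fin = \<open>fin_tree_sequent \<Gamma>' T' \<Delta>'\<close> and fresh = seq_nats_memD[OF BoxR.hyps(2)]
  obtain i' where i': "i' \<notin> seq_nats \<Gamma>' T' \<Delta>'"
    using ex_new_if_finite[OF infinite_UNIV_nat finite_seq_nats[OF fin]] by blast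
  let ?\<tau> = "\<tau>(i := i')"
  have fm: "relfm \<sigma> ?\<tau> x = relfm \<sigma> \<tau> x" if "x \<in> \<Gamma> \<union> insert (\<alpha>, At n (Box \<phi>)) \<Delta>" for x
    using fresh(1,2)[of x] that by (intro relfm_cong) auto
  have lab: "relab \<sigma> ?\<tau> \<beta> = relab \<sigma> \<tau> \<beta>" if "\<beta> \<in> T" for \<beta>
    using fresh(3)[OF that] by (intro relab_cong) auto
  have prems: "relfm \<sigma> ?\<tau> ` \<Gamma> \<subseteq> \<Gamma>'" "relab \<sigma> ?\<tau> ` T \<subseteq> T'"
    "relfm \<sigma> ?\<tau> ` (insert (\<alpha>, At n (Box \<phi>)) \<Delta>) \<subseteq> \<Delta>'"
    using BoxR.prems fm lab by (auto simp del: relfm_Pair simp: image_subset_iff)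
  have "derivable \<Gamma>' (insert (Child (relab \<sigma> ?\<tau> \<alpha>) (\<sigma> n) i') T')
     (insert (Child (relab \<sigma> ?\<tau> \<alpha>) (\<sigma> n) i', At (\<sigma> n) (map_fm id \<sigma> \<phi>)) \<Delta>')"
    using prems fin_tree_sequent_memD[OF fin] fin
    by (intro BoxR.IH[of \<sigma> ?\<tau>])
       (auto simp del: fun_upd_apply simp: fun_upd_same intro!: fin_tree_sequent_insert_Child)
  with prems i' show ?case
    by (rule_tac derivable_BoxR[OF fin, of "relab \<sigma> ?\<tau> \<alpha>" "\<sigma> n"]) (auto simp del: fun_upd_apply)
next
  case (BoxL \<beta> n \<phi> \<Gamma> T \<Delta> \<alpha> i)
  have "relab \<sigma> \<tau> \<beta> \<in> T'"
    using derivable_fin_tree_sequent[OF BoxL.hyps(1)] BoxL.prems by auto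
  then have "derivable (insert (Child (relab \<sigma> \<tau> \<alpha>) (\<sigma> n) (\<tau> i), At (\<sigma> n) (map_fm id \<sigma> \<phi>)) \<Gamma>') T' \<Delta>'"
    using BoxL.prems BoxL.hyps(2) by (intro BoxL.IH[of \<sigma> \<tau>]) auto
  with BoxL.prems show ?case
    by (rule_tac derivable_BoxL[of _ _ _ "relab \<sigma> \<tau> \<alpha>" "\<sigma> n"]) auto
next
  case (wlab \<Gamma> T \<Delta> \<alpha>)
  \<comment> \<open>The target tree contains the image of the smaller tree as well, so the induction
    hypothesis applies to the same target.\<close>
  then show ?case by auto
qed

text \<open>The identity renaming, into a larger target. Infinitely many nominals guarantee that
  fresh ones for \<open>FR\<close> can be chosen anew.\<close>

corollary derivable_weaken:
  fixes \<Gamma> \<Delta> :: "('p, 'n::infinite) lfm set"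
  assumes "derivable \<Gamma> T \<Delta>" "\<Gamma> \<subseteq> \<Gamma>'" "T \<subseteq> T'" "\<Delta> \<subseteq> \<Delta>'" "fin_tree_sequent \<Gamma>' T' \<Delta>'"
  shows "derivable \<Gamma>' T' \<Delta>'"
  using derivable_rename[OF assms(1), of id id] assms(2-) by simp

section \<open>Rules for possibly infinite sequents\<close>

text \<open>A label has finitely many ancestors, and together with it they form a finite subtree.
  Unions of such subtrees are trees because all share the root of \<open>T\<close>.\<close>

lemma finite_subtree:
  assumes "tree T" "finite F" "F \<subseteq> T"
  obtains T' where "finite T'" "tree T'" "F \<subseteq> T'" "T' \<subseteq> T"
proof -
  obtain r where r: "Root r \<in> T" using assms(1) by (auto simp: tree_def)
  have "\<exists>T'. finite T' \<and> tree T' \<and> Root r \<in> T' \<and> \<alpha> \<in> T' \<and> T' \<subseteq> T" if "\<alpha> \<in> T" for \<alpha>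
    using that
  proof (induction \<alpha>)
    case (Root j)
    then have "j = r" using r assms(1) by (auto simp: tree_def)
    then show ?case using r by (intro exI[of _ "{Root r}"]) (auto simp: tree_def)
  next
    case (Child \<alpha> n i)
    then have "\<alpha> \<in> T" using assms(1) by (auto simp: tree_def)
    with Child.IH obtain T' where "finite T'" "tree T'" "Root r \<in> T'" "\<alpha> \<in> T'" "T' \<subseteq> T" by blast
    then show ?case using Child.prems
      by (intro exI[of _ "insert (Child \<alpha> n i) T'"]) (auto intro: tree_insert_Child)
  qed
  then obtain t where t: "\<And>\<alpha>. \<alpha> \<in> T \<Longrightarrow>
      finite (t \<alpha>) \<and> tree (t \<alpha>) \<and> Root r \<in> t \<alpha> \<and> \<alpha> \<in> t \<alpha> \<and> t \<alpha> \<subseteq> T" by metis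
  \<comment> \<open>Inserting the root makes the union a tree even for empty
    \<open>F\<close>.\<close>
  let ?T = "\<Union>(t ` insert (Root r) F)"
  have sub: "?T \<subseteq> T" using t r assms(3) by blast
  moreover have "tree ?T"
    unfolding tree_def
  proof (intro conjI allI impI)
    show "\<exists>!i. Root i \<in> ?T"
    proof (rule ex1I[of _ r])
      show "Root r \<in> ?T" using t r by blast
      show "\<And>i. Root i \<in> ?T \<Longrightarrow> i = r" using sub r assms(1) unfolding tree_def by blast
    qed
    fix \<alpha> n i assume "Child \<alpha> n i \<in> ?T"
    then obtain \<beta> where "\<beta> \<in> insert (Root r) F" "Child \<alpha> n i \<in> t \<beta>" by blast
    moreover from this have "tree (t \<beta>)" using t r assms(3) by blast
    ultimately show "\<alpha> \<in> ?T" by (auto simp: tree_def)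
  qed
  moreover have "finite ?T" using t r assms(2,3) by blast
  moreover have "F \<subseteq> ?T" using t assms(3) by blast
  ultimately show ?thesis using that by blast
qed

text \<open>The finite part that witnesses provability may omit some of \<open>A\<close>,
  \<open>N\<close>, \<open>B\<close>. By weakening it can be replaced by any larger finite sequent,
  so thresholds belonging to several premises can be united.\<close>

lemma provable_cofinal:
  fixes \<Gamma> \<Delta> :: "('p, 'n::infinite) lfm set"
  assumes "provable (A \<union> \<Gamma>) (N \<union> T) (B \<union> \<Delta>)"
  shows "\<exists>\<Gamma>\<^sub>0 T\<^sub>0 \<Delta>\<^sub>0. finite \<Gamma>\<^sub>0 \<and> \<Gamma>\<^sub>0 \<subseteq> \<Gamma> \<and> finite T\<^sub>0 \<and> T\<^sub>0 \<subseteq> T \<and> finite \<Delta>\<^sub>0 \<and> \<Delta>\<^sub>0 \<subseteq> \<Delta> \<and>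
    (\<forall>\<Gamma>' T' \<Delta>'. \<Gamma>\<^sub>0 \<subseteq> \<Gamma>' \<longrightarrow> T\<^sub>0 \<subseteq> T' \<longrightarrow> \<Delta>\<^sub>0 \<subseteq> \<Delta>' \<longrightarrow>
       fin_tree_sequent (A \<union> \<Gamma>') (N \<union> T') (B \<union> \<Delta>') \<longrightarrow> derivable (A \<union> \<Gamma>') (N \<union> T') (B \<union> \<Delta>'))"
proof -
  obtain \<Gamma>\<^sub>1 T\<^sub>1 \<Delta>\<^sub>1 where *: "\<Gamma>\<^sub>1 \<subseteq> A \<union> \<Gamma>" "finite \<Gamma>\<^sub>1" "T\<^sub>1 \<subseteq> N \<union> T" "finite T\<^sub>1"
    "\<Delta>\<^sub>1 \<subseteq> B \<union> \<Delta>" "finite \<Delta>\<^sub>1" and d: "derivable \<Gamma>\<^sub>1 T\<^sub>1 \<Delta>\<^sub>1"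
    using assms unfolding provable_def by blast
  show ?thesis
  proof (intro exI conjI allI impI)
    \<comment> \<open>The assumptions that follow fix the threshold: the portion of the finite
      derivable sequent inside \<open>\<Gamma>\<close>, \<open>T\<close>, \<open>\<Delta>\<close>.
      The rest of that sequent lies in \<open>A\<close>, \<open>N\<close>, \<open>B\<close>.\<close>
    fix \<Gamma>' T' \<Delta>'
    assume "\<Gamma>\<^sub>1 \<inter> \<Gamma> \<subseteq> \<Gamma>'" "T\<^sub>1 \<inter> T \<subseteq> T'" "\<Delta>\<^sub>1 \<inter> \<Delta> \<subseteq> \<Delta>'"
      and fin: "fin_tree_sequent (A \<union> \<Gamma>') (N \<union> T') (B \<union> \<Delta>')"
    with * have "\<Gamma>\<^sub>1 \<subseteq> A \<union> \<Gamma>'" "T\<^sub>1 \<subseteq> N \<union> T'" "\<Delta>\<^sub>1 \<subseteq> B \<union> \<Delta>'" by blast+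
    from d this fin show "derivable (A \<union> \<Gamma>') (N \<union> T') (B \<union> \<Delta>')" by (rule_tac derivable_weaken)
  qed (use * in auto)
qed

text \<open>Lifts a rule of the calculus, whose premises add \<open>A\<close>, \<open>N\<close> and \<open>B\<close> to the conclusion for
  \<open>(A, N, B) \<in> P\<close>, to possibly infinite sequents.\<close>

lemma provable_rule:
  fixes \<Gamma> \<Delta> :: "('p, 'n::infinite) lfm set"
  assumes seq: "tree_sequent \<Gamma> T \<Delta>"
    and "finite P" "finite C" "C \<subseteq> \<Gamma>" "finite D" "D \<subseteq> \<Delta>" "finite E" "E \<subseteq> T"
    and prems: "\<forall>(A, N, B) \<in> P. provable (A \<union> \<Gamma>) (N \<union> T) (B \<union> \<Delta>)"
    and fin: "\<And>\<Gamma>' T' \<Delta>'. fin_tree_sequent \<Gamma>' T' \<Delta>' \<Longrightarrow> C \<subseteq> \<Gamma>' \<Longrightarrow> E \<subseteq> T' \<Longrightarrow> D \<subseteq> \<Delta>' \<Longrightarrow>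
        \<forall>(A, N, B) \<in> P. fin_tree_sequent (A \<union> \<Gamma>') (N \<union> T') (B \<union> \<Delta>')"
    and rule: "\<And>\<Gamma>' T' \<Delta>'. fin_tree_sequent \<Gamma>' T' \<Delta>' \<Longrightarrow> C \<subseteq> \<Gamma>' \<Longrightarrow> E \<subseteq> T' \<Longrightarrow> D \<subseteq> \<Delta>' \<Longrightarrow>
        \<Gamma>' \<subseteq> \<Gamma> \<Longrightarrow> T' \<subseteq> T \<Longrightarrow> \<Delta>' \<subseteq> \<Delta> \<Longrightarrow>
        \<forall>(A, N, B) \<in> P. derivable (A \<union> \<Gamma>') (N \<union> T') (B \<union> \<Delta>') \<Longrightarrow> derivable \<Gamma>' T' \<Delta>'"
  shows "provable \<Gamma> T \<Delta>"
proof -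
  have "\<forall>p\<in>P. \<exists>\<Gamma>\<^sub>0 T\<^sub>0 \<Delta>\<^sub>0. finite \<Gamma>\<^sub>0 \<and> \<Gamma>\<^sub>0 \<subseteq> \<Gamma> \<and> finite T\<^sub>0 \<and> T\<^sub>0 \<subseteq> T \<and> finite \<Delta>\<^sub>0 \<and> \<Delta>\<^sub>0 \<subseteq> \<Delta> \<and>
    (\<forall>\<Gamma>' T' \<Delta>'. \<Gamma>\<^sub>0 \<subseteq> \<Gamma>' \<longrightarrow> T\<^sub>0 \<subseteq> T' \<longrightarrow> \<Delta>\<^sub>0 \<subseteq> \<Delta>' \<longrightarrow>
       fin_tree_sequent (fst p \<union> \<Gamma>') (fst (snd p) \<union> T') (snd (snd p) \<union> \<Delta>') \<longrightarrow>
       derivable (fst p \<union> \<Gamma>') (fst (snd p) \<union> T') (snd (snd p) \<union> \<Delta>'))"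
    using prems by (intro ballI provable_cofinal) auto
  then obtain G U H where
    fin_sub: "\<And>p. p \<in> P \<Longrightarrow>
      finite (G p) \<and> G p \<subseteq> \<Gamma> \<and> finite (U p) \<and> U p \<subseteq> T \<and> finite (H p) \<and> H p \<subseteq> \<Delta>"
    and cofinal: "\<And>p \<Gamma>' T' \<Delta>'. p \<in> P \<Longrightarrow> G p \<subseteq> \<Gamma>' \<Longrightarrow> U p \<subseteq> T' \<Longrightarrow> H p \<subseteq> \<Delta>' \<Longrightarrow>
       fin_tree_sequent (fst p \<union> \<Gamma>') (fst (snd p) \<union> T') (snd (snd p) \<union> \<Delta>') \<Longrightarrow>
       derivable (fst p \<union> \<Gamma>') (fst (snd p) \<union> T') (snd (snd p) \<union> \<Delta>')"
    unfolding bchoice_iff by metis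
  \<comment> \<open>Principal formulas together with the thresholds of all premises: one finite
    conclusion for which every premise is derivable.\<close>
  define \<Gamma>' where "\<Gamma>' = C \<union> \<Union>(G ` P)"
  define \<Delta>' where "\<Delta>' = D \<union> \<Union>(H ` P)"
  have sub: "\<Gamma>' \<subseteq> \<Gamma>" "\<Delta>' \<subseteq> \<Delta>" and fins: "finite \<Gamma>'" "finite \<Delta>'"
    unfolding \<Gamma>'_def \<Delta>'_def using assms(2-8) fin_sub by blast+
  have "fst ` (\<Gamma>' \<union> \<Delta>') \<subseteq> T"
    using sub seq by (force simp: tree_sequent_def)
  \<comment> \<open>The finite tree also has to carry the labels of the formulas just
    collected.\<close>
  then have "E \<union> \<Union>(U ` P) \<union> fst ` (\<Gamma>' \<union> \<Delta>') \<subseteq> T"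
    using assms(8) fin_sub by blast
  moreover have "finite (E \<union> \<Union>(U ` P) \<union> fst ` (\<Gamma>' \<union> \<Delta>'))"
    using assms(2,7) fin_sub fins by simp
  ultimately obtain T' where T': "finite T'" "tree T'" "E \<union> \<Union>(U ` P) \<union> fst ` (\<Gamma>' \<union> \<Delta>') \<subseteq> T'" "T' \<subseteq> T"
    using finite_subtree seq unfolding tree_sequent_def by metis
  have "\<alpha> \<in> T' \<and> at_prefixed \<psi>" if "(\<alpha>, \<psi>) \<in> \<Gamma>' \<union> \<Delta>'" for \<alpha> \<psi>
  proof
    have "fst (\<alpha>, \<psi>) \<in> T'" using that T'(3) by blast
    then show "\<alpha> \<in> T'" by simp
    show "at_prefixed \<psi>" using that sub tree_sequent_memD[OF seq] by blast
  qed
  then have seq': "fin_tree_sequent \<Gamma>' T' \<Delta>'"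
    unfolding fin_tree_sequent_def tree_sequent_def using T' fins by blast
  have incl: "C \<subseteq> \<Gamma>'" "D \<subseteq> \<Delta>'" "E \<subseteq> T'"
    using T' by (auto simp: \<Gamma>'_def \<Delta>'_def)
  have "derivable (A \<union> \<Gamma>') (N \<union> T') (B \<union> \<Delta>')" if "(A, N, B) \<in> P" for A N B
  proof -
    have "G (A, N, B) \<subseteq> \<Gamma>'" "U (A, N, B) \<subseteq> T'" "H (A, N, B) \<subseteq> \<Delta>'"
      using that T'(3) by (auto simp: \<Gamma>'_def \<Delta>'_def)
    then show ?thesis
      using cofinal[OF that] bspec[OF fin[OF seq' incl(1,3,2)] that] by simp
  qed
  then have "derivable \<Gamma>' T' \<Delta>'"
    using seq' incl sub T' by (intro rule) auto
  then show ?thesis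
    unfolding provable_def using sub fins T' by blast
qed

lemma provable_mono:
  "provable \<Gamma> T \<Delta> \<Longrightarrow> \<Gamma> \<subseteq> \<Gamma>' \<Longrightarrow> T \<subseteq> T' \<Longrightarrow> \<Delta> \<subseteq> \<Delta>' \<Longrightarrow> provable \<Gamma>' T' \<Delta>'"
  unfolding provable_def by (meson subset_trans)

text \<open>The finite part that a derivation uses is not known in advance, so \<open>m\<close> is
  fresh for the whole sequent; by monotonicity of \<open>seq_noms\<close> it is then fresh for every
  part.\<close>

lemma provable_FR:
  fixes \<Gamma> \<Delta> :: "('p, 'n::infinite) lfm set"
  assumes "tree_sequent \<Gamma> T \<Delta>" "(\<alpha>, At n (Fr \<phi>)) \<in> \<Delta>" "m \<notin> seq_noms \<Gamma> T \<Delta>"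
    and "provable (insert (\<alpha>, At n (DiaF (Nom m))) \<Gamma>) T (insert (\<alpha>, At m \<phi>) \<Delta>)"
  shows "provable \<Gamma> T \<Delta>"
proof (rule provable_rule[where C = "{}" and D = "{(\<alpha>, At n (Fr \<phi>))}" and E = "{}"
      and P = "{({(\<alpha>, At n (DiaF (Nom m)))}, {}, {(\<alpha>, At m \<phi>)})}"])
  fix \<Gamma>' T' \<Delta>'
  assume fin: "fin_tree_sequent \<Gamma>' T' \<Delta>'" and D: "{(\<alpha>, At n (Fr \<phi>))} \<subseteq> \<Delta>'"
  then show "\<forall>(A, N, B) \<in> {({(\<alpha>, At n (DiaF (Nom m)))}, {}, {(\<alpha>, At m \<phi>)})}.
      fin_tree_sequent (A \<union> \<Gamma>') (N \<union> T') (B \<union> \<Delta>')"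
    by (auto dest: fin_tree_sequent_memD)
  assume "\<Gamma>' \<subseteq> \<Gamma>" "T' \<subseteq> T" "\<Delta>' \<subseteq> \<Delta>"
  then have "m \<notin> seq_noms \<Gamma>' T' \<Delta>'"
    using assms(3) seq_noms_mono by blast
  moreover assume "\<forall>(A, N, B) \<in> {({(\<alpha>, At n (DiaF (Nom m)))}, {}, {(\<alpha>, At m \<phi>)})}.
      derivable (A \<union> \<Gamma>') (N \<union> T') (B \<union> \<Delta>')"
  ultimately show "derivable \<Gamma>' T' \<Delta>'"
    using D by (rule_tac derivable_FR[OF fin]) auto
qed (use assms in auto)

text \<open>Freshness passes to finite parts as for \<open>FR\<close>. This is the one rule whose
  premise enlarges the tree, hence the middle component of the premise triples.\<close>

lemma provable_BoxR:
  fixes \<Gamma> \<Delta> :: "('p, 'n::infinite) lfm set"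
  assumes "tree_sequent \<Gamma> T \<Delta>" "(\<alpha>, At n (Box \<phi>)) \<in> \<Delta>" "i \<notin> seq_nats \<Gamma> T \<Delta>"
    and "provable \<Gamma> (insert (Child \<alpha> n i) T) (insert (Child \<alpha> n i, At n \<phi>) \<Delta>)"
  shows "provable \<Gamma> T \<Delta>"
proof (rule provable_rule[where C = "{}" and D = "{(\<alpha>, At n (Box \<phi>))}" and E = "{}"
      and P = "{({}, {Child \<alpha> n i}, {(Child \<alpha> n i, At n \<phi>)})}"])
  fix \<Gamma>' T' \<Delta>'
  assume fin: "fin_tree_sequent \<Gamma>' T' \<Delta>'" and D: "{(\<alpha>, At n (Box \<phi>))} \<subseteq> \<Delta>'"
  then show "\<forall>(A, N, B) \<in> {({}, {Child \<alpha> n i}, {(Child \<alpha> n i, At n \<phi>)})}.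
      fin_tree_sequent (A \<union> \<Gamma>') (N \<union> T') (B \<union> \<Delta>')"
    by (auto dest: fin_tree_sequent_memD intro: fin_tree_sequent_insert_Child)
  assume "\<Gamma>' \<subseteq> \<Gamma>" "T' \<subseteq> T" "\<Delta>' \<subseteq> \<Delta>"
  then have "i \<notin> seq_nats \<Gamma>' T' \<Delta>'"
    using assms(3) seq_nats_mono by blast
  moreover assume "\<forall>(A, N, B) \<in> {({}, {Child \<alpha> n i}, {(Child \<alpha> n i, At n \<phi>)})}.
      derivable (A \<union> \<Gamma>') (N \<union> T') (B \<union> \<Delta>')"
  ultimately show "derivable \<Gamma>' T' \<Delta>'"
    using D by (rule_tac derivable_BoxR[OF fin]) auto
qed (use assms in auto)

section \<open>Saturated sequents and their closure properties\<close>

locale saturated =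
  fixes \<Gamma> \<Delta> :: "('p, 'n::infinite) lfm set" and T :: "'n label set"
  assumes seq: "tree_sequent \<Gamma> T \<Delta>"
    and unprovable: "\<not> provable \<Gamma> T \<Delta>"
    and maximal_left: "\<alpha> \<in> T \<Longrightarrow> at_prefixed \<psi> \<Longrightarrow> (\<alpha>, \<psi>) \<notin> \<Gamma> \<Longrightarrow> provable (insert (\<alpha>, \<psi>) \<Gamma>) T \<Delta>"
    and maximal_right: "\<alpha> \<in> T \<Longrightarrow> at_prefixed \<psi> \<Longrightarrow> (\<alpha>, \<psi>) \<notin> \<Delta> \<Longrightarrow> provable \<Gamma> T (insert (\<alpha>, \<psi>) \<Delta>)"
    and witness_F: "(\<alpha>, At n (Fr \<phi>)) \<in> \<Delta> \<Longrightarrow>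
        \<exists>m. (\<alpha>, At n (DiaF (Nom m))) \<in> \<Gamma> \<and> (\<alpha>, At m \<phi>) \<in> \<Delta>"
    and witness_Box: "(\<alpha>, At n (Box \<phi>)) \<in> \<Delta> \<Longrightarrow>
        \<exists>i. Child \<alpha> n i \<in> T \<and> (Child \<alpha> n i, At n \<phi>) \<in> \<Delta>"
begin

text \<open>If no formula of \<open>X\<close> were on the left and none of \<open>Y\<close> on the
  right, maximality would make every premise provable and the rule would prove the saturated
  sequent. \<open>C\<close> and \<open>D\<close> hold the principal formulas; each member of
  \<open>X\<close> or \<open>Y\<close> stands for one premise, which adds just that formula. This
  serves all rules without fresh symbols.\<close>

lemma closed_under_rule:
  assumes "finite C" "C \<subseteq> \<Gamma>" "finite D" "D \<subseteq> \<Delta>" "finite X" "finite Y"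
    and lab: "\<forall>x\<in>X \<union> Y. fst x \<in> T \<and> at_prefixed (snd x)"
    and rule: "\<And>\<Gamma>' T' \<Delta>'. fin_tree_sequent \<Gamma>' T' \<Delta>' \<Longrightarrow> C \<subseteq> \<Gamma>' \<Longrightarrow> D \<subseteq> \<Delta>' \<Longrightarrow>
        \<forall>x\<in>X. derivable (insert x \<Gamma>') T' \<Delta>' \<Longrightarrow> \<forall>y\<in>Y. derivable \<Gamma>' T' (insert y \<Delta>') \<Longrightarrow>
        derivable \<Gamma>' T' \<Delta>'"
  shows "(\<exists>x\<in>X. x \<in> \<Gamma>) \<or> (\<exists>y\<in>Y. y \<in> \<Delta>)"
proof (rule ccontr)
  let ?P = "(\<lambda>x. ({x}, {}, {})) ` X \<union> (\<lambda>y. ({}, {}, {y})) ` Y"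
  assume none: "\<not> ((\<exists>x\<in>X. x \<in> \<Gamma>) \<or> (\<exists>y\<in>Y. y \<in> \<Delta>))"
  have left: "provable (insert x \<Gamma>) T \<Delta>" if "x \<in> X" for x
    using maximal_left[of "fst x" "snd x"] lab none that by auto
  have right: "provable \<Gamma> T (insert y \<Delta>)" if "y \<in> Y" for y
    using maximal_right[of "fst y" "snd y"] lab none that by auto
  have "provable \<Gamma> T \<Delta>"
  \<comment> \<open>The choice of \<open>E\<close> puts the labels of the added formulas into the
    finite tree. In \<open>ref\<close>, \<open>rigid\<close> and \<open>BoxL\<close> they need not
    be labels of principal formulas.\<close>
  proof (rule provable_rule[OF seq, where P = ?P and C = C and D = D and E = "fst ` (X \<union> Y)"])
    fix \<Gamma>' \<Delta>' :: "('p, 'n) lfm set" and T'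
    assume fin: "fin_tree_sequent \<Gamma>' T' \<Delta>'" and CDE: "C \<subseteq> \<Gamma>'" "fst ` (X \<union> Y) \<subseteq> T'" "D \<subseteq> \<Delta>'"
    then have "fst x \<in> T' \<and> at_prefixed (snd x)" if "x \<in> X \<union> Y" for x
      using lab that by blast
    with fin show "\<forall>(A, N, B) \<in> ?P. fin_tree_sequent (A \<union> \<Gamma>') (N \<union> T') (B \<union> \<Delta>')"
      by (simp add: ball_Un)
    assume "\<forall>(A, N, B) \<in> ?P. derivable (A \<union> \<Gamma>') (N \<union> T') (B \<union> \<Delta>')"
    then show "derivable \<Gamma>' T' \<Delta>'"
      by (intro rule[OF fin CDE(1,3)]) (simp_all add: ball_Un)
  next
    show "\<forall>(A, N, B) \<in> ?P. provable (A \<union> \<Gamma>) (N \<union> T) (B \<union> \<Delta>)"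
      using left right by (simp add: ball_Un)
    show "fst ` (X \<union> Y) \<subseteq> T"
      using lab by blast
  qed (use assms(1-6) in simp_all)
  with unprovable show False ..
qed

text \<open>An initial sequent is a rule without premises: for empty \<open>X\<close> and
  \<open>Y\<close> the conclusion of \<open>closed_under_rule\<close> is
  \<open>False\<close>.\<close>

lemma disjoint: "(\<alpha>, At n \<phi>) \<in> \<Gamma> \<Longrightarrow> (\<alpha>, At n \<phi>) \<notin> \<Delta>"
  by (rule notI, rule closed_under_rule[of "{(\<alpha>, At n \<phi>)}" "{(\<alpha>, At n \<phi>)}" "{}" "{}", simplified])
    (auto intro: derivable_init_id)

lemma not_Bot: "(\<alpha>, At n Bot) \<notin> \<Gamma>"
  by (rule notI, rule closed_under_rule[of "{(\<alpha>, At n Bot)}" "{}" "{}" "{}", simplified])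
    (auto intro: derivable_init_bot)

lemma rep2_closed:
  assumes "(\<alpha>, At n (Nom m)) \<in> \<Gamma>" "(\<alpha>, subst \<phi> n k) \<in> \<Gamma>"
  shows "(\<alpha>, subst \<phi> m k) \<in> \<Gamma>"
  by (rule closed_under_rule[of "{(\<alpha>, At n (Nom m)), (\<alpha>, subst \<phi> n k)}" "{}"
        "{(\<alpha>, subst \<phi> m k)}" "{}", simplified])
    (use assms tree_sequent_memD(1)[OF seq assms(2)] in \<open>auto intro: derivable_rep2[of _ _ _ \<alpha> n m \<phi> k]\<close>)

lemma ref_closed: "\<alpha> \<in> T \<Longrightarrow> (\<alpha>, At n (Nom n)) \<in> \<Gamma>"
  by (rule closed_under_rule[of "{}" "{}" "{(\<alpha>, At n (Nom n))}" "{}", simplified])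
    (auto intro: derivable_ref[of _ _ _ \<alpha> n])

lemma rigid_closed: "(\<alpha>, At n (Nom m)) \<in> \<Gamma> \<Longrightarrow> \<beta> \<in> T \<Longrightarrow> (\<beta>, At n (Nom m)) \<in> \<Gamma>"
  by (rule closed_under_rule[of "{(\<alpha>, At n (Nom m))}" "{}" "{(\<beta>, At n (Nom m))}" "{}", simplified])
    (auto intro: derivable_rigid[of _ _ _ \<alpha> n m \<beta>])

text \<open>The premise of \<open>ImpR\<close> adds a formula on each side, whereas
  \<open>closed_under_rule\<close> allows one formula per premise. Weakening splits the rule into
  two one-sided versions, in which only \<open>\<phi>\<close> or only \<open>\<psi>\<close> is
  added.\<close>

lemma ImpR_closed:
  assumes "(\<alpha>, At n (Imp \<phi> \<psi>)) \<in> \<Delta>"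
  shows "(\<alpha>, At n \<phi>) \<in> \<Gamma>" "(\<alpha>, At n \<psi>) \<in> \<Delta>"
proof -
  have \<alpha>: "\<alpha> \<in> T" using assms tree_sequent_memD[OF seq] by auto
  have 1: "derivable \<Gamma>' T' \<Delta>'" if "fin_tree_sequent \<Gamma>' T' \<Delta>'" "(\<alpha>, At n (Imp \<phi> \<psi>)) \<in> \<Delta>'"
    "derivable (insert (\<alpha>, At n \<phi>) \<Gamma>') T' \<Delta>'" for \<Gamma>' T' \<Delta>'
    using that by (rule_tac derivable_ImpR[OF that(1,2) derivable_weaken[OF that(3)]])
      (auto dest: fin_tree_sequent_memD)
  have 2: "derivable \<Gamma>' T' \<Delta>'" if "fin_tree_sequent \<Gamma>' T' \<Delta>'" "(\<alpha>, At n (Imp \<phi> \<psi>)) \<in> \<Delta>'"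
    "derivable \<Gamma>' T' (insert (\<alpha>, At n \<psi>) \<Delta>')" for \<Gamma>' T' \<Delta>'
    using that by (rule_tac derivable_ImpR[OF that(1,2) derivable_weaken[OF that(3)]])
      (auto dest: fin_tree_sequent_memD)
  show "(\<alpha>, At n \<phi>) \<in> \<Gamma>"
    by (rule closed_under_rule[of "{}" "{(\<alpha>, At n (Imp \<phi> \<psi>))}" "{(\<alpha>, At n \<phi>)}" "{}", simplified])
      (use assms \<alpha> 1 in auto)
  show "(\<alpha>, At n \<psi>) \<in> \<Delta>"
    by (rule closed_under_rule[of "{}" "{(\<alpha>, At n (Imp \<phi> \<psi>))}" "{}" "{(\<alpha>, At n \<psi>)}", simplified])
      (use assms \<alpha> 2 in auto)
qed

lemma ImpL_closed:
  assumes "(\<alpha>, At n (Imp \<phi> \<psi>)) \<in> \<Gamma>"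
  shows "(\<alpha>, At n \<psi>) \<in> \<Gamma> \<or> (\<alpha>, At n \<phi>) \<in> \<Delta>"
  by (rule closed_under_rule[of "{(\<alpha>, At n (Imp \<phi> \<psi>))}" "{}" "{(\<alpha>, At n \<psi>)}" "{(\<alpha>, At n \<phi>)}", simplified])
    (use assms tree_sequent_memD(1)[OF seq assms] in \<open>auto intro: derivable_ImpL[of _ _ _ \<alpha> n \<phi> \<psi>]\<close>)

lemma AtR_closed:
  assumes "(\<alpha>, At n (At m \<phi>)) \<in> \<Delta>"
  shows "(\<alpha>, At m \<phi>) \<in> \<Delta>"
  by (rule closed_under_rule[of "{}" "{(\<alpha>, At n (At m \<phi>))}" "{}" "{(\<alpha>, At m \<phi>)}", simplified])
    (use assms tree_sequent_memD(2)[OF seq assms] in \<open>auto intro: derivable_AtR[of _ _ _ \<alpha> n m \<phi>]\<close>)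

lemma AtL_closed:
  assumes "(\<alpha>, At n (At m \<phi>)) \<in> \<Gamma>"
  shows "(\<alpha>, At m \<phi>) \<in> \<Gamma>"
  by (rule closed_under_rule[of "{(\<alpha>, At n (At m \<phi>))}" "{}" "{(\<alpha>, At m \<phi>)}" "{}", simplified])
    (use assms tree_sequent_memD(1)[OF seq assms] in \<open>auto intro: derivable_AtL[of _ _ _ \<alpha> n m \<phi>]\<close>)

text \<open>Here \<open>m\<close> is any nominal. If \<open>DiaF (Nom m)\<close> is on the left,
  \<open>disjoint\<close> excludes the second alternative, which is what the truth lemma
  exploits.\<close>

lemma FL_closed:
  assumes "(\<alpha>, At n (Fr \<phi>)) \<in> \<Gamma>"
  shows "(\<alpha>, At m \<phi>) \<in> \<Gamma> \<or> (\<alpha>, At n (DiaF (Nom m))) \<in> \<Delta>"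
  by (rule closed_under_rule[of "{(\<alpha>, At n (Fr \<phi>))}" "{}" "{(\<alpha>, At m \<phi>)}"
        "{(\<alpha>, At n (DiaF (Nom m)))}", simplified])
    (use assms tree_sequent_memD(1)[OF seq assms] in \<open>auto intro: derivable_FL[of _ _ _ \<alpha> n \<phi> m]\<close>)

lemma BoxL_closed:
  assumes "(\<alpha>, At n (Box \<phi>)) \<in> \<Gamma>" "Child \<alpha> n i \<in> T"
  shows "(Child \<alpha> n i, At n \<phi>) \<in> \<Gamma>"
  by (rule closed_under_rule[of "{(\<alpha>, At n (Box \<phi>))}" "{}" "{(Child \<alpha> n i, At n \<phi>)}" "{}", simplified])
    (use assms in \<open>auto intro: derivable_BoxL[of _ _ _ \<alpha> n \<phi> i]\<close>)

section \<open>The canonical countermodel\<close>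

text \<open>Independent of a label, because \<open>rigid\<close> carries an equation from one label
  to all others; nominals thereby denote the same agent in every world.\<close>

definition eqn :: "'n \<Rightarrow> 'n \<Rightarrow> bool" where
  "eqn n m \<longleftrightarrow> (\<exists>\<alpha>. (\<alpha>, At n (Nom m)) \<in> \<Gamma>)"

lemma eqn_iff: "\<alpha> \<in> T \<Longrightarrow> eqn n m \<longleftrightarrow> (\<alpha>, At n (Nom m)) \<in> \<Gamma>"
  unfolding eqn_def using rigid_closed by blast

lemma T_nonempty: "T \<noteq> {}"
  using seq by (auto simp: tree_sequent_def tree_def)

text \<open>Replacement rewrites every occurrence of a nominal, but here the prefix alone has to
  change. A nominal \<open>k\<close> not in \<open>\<phi>\<close> marks the prefix: both formulas
  are instances of \<open>At k \<phi>\<close>.\<close>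

lemma At_cong:
  assumes "eqn n m" "(\<alpha>, At n \<phi>) \<in> \<Gamma>"
  shows "(\<alpha>, At m \<phi>) \<in> \<Gamma>"
proof -
  obtain k where k: "k \<notin> noms \<phi>"
    using ex_new_if_finite[OF infinite_UNIV finite_noms] by blast
  have *: "subst (At k \<phi>) l k = At l \<phi>" for l
    using k by (auto simp: subst_def intro!: fm.map_ident_strong)
  have "(\<alpha>, At n (Nom m)) \<in> \<Gamma>"
    using assms eqn_iff tree_sequent_memD[OF seq] by blast
  from rep2_closed[OF this, of "At k \<phi>" k] show ?thesis
    using assms by (simp add: *)
qed

lemma eqn_refl: "eqn n n"
  using T_nonempty ref_closed eqn_iff by blast

text \<open>The prefix of the reflexive equation \<open>At n (Nom n)\<close> is changed to
  \<open>m\<close>.\<close>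

lemma eqn_sym: "eqn n m \<Longrightarrow> eqn m n"
  using At_cong eqn_refl unfolding eqn_def by blast

lemma eqn_trans: "eqn n m \<Longrightarrow> eqn m l \<Longrightarrow> eqn n l"
  using At_cong eqn_sym unfolding eqn_def by blast

text \<open>Classes are represented by nominals rather than by sets of nominals, so that an
  injection of nominals into \<open>'a\<close> also places the agents there.\<close>

definition rep :: "'n \<Rightarrow> 'n" where
  "rep n = (SOME m. eqn n m)"

lemma rep_eq_iff: "rep n = rep m \<longleftrightarrow> eqn n m"
proof
  have *: "eqn k (rep k)" for k
    unfolding rep_def using eqn_refl by (rule someI)
  show "eqn n m" if "rep n = rep m"
    using *[of n] *[of m] that eqn_sym eqn_trans by metis
  assume "eqn n m"
  \<comment> \<open>The choice in \<open>rep\<close> depends only on this predicate.\<close>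
  then have "eqn n = eqn m"
    using eqn_sym eqn_trans by blast
  then show "rep n = rep m"
    by (simp add: rep_def)
qed

text \<open>The maps \<open>g\<close> and \<open>h\<close> copy labels and nominals into the
  prescribed types. Every agent is named by a nominal. Only the left-hand side determines
  \<open>friend\<close> and the propositional part of \<open>val\<close>, so an atom that is on
  neither side counts as false unless it agrees with one on the left up to equations.\<close>

definition canonical :: "('n label \<Rightarrow> 'w) \<Rightarrow> ('n \<Rightarrow> 'a) \<Rightarrow> ('w, 'a, 'p, 'n) model" where
  "canonical g h = \<lparr>
     worlds = g ` T,
     agents = range (\<lambda>n. h (rep n)),
     know = \<lambda>a. {(g \<alpha>, g (Child \<alpha> n i)) | \<alpha> n i. Child \<alpha> n i \<in> T \<and> h (rep n) = a},
     friend = \<lambda>w. {(h (rep n), h (rep m)) | n m. \<exists>\<alpha>. w = g \<alpha> \<and> (\<alpha>, At n (DiaF (Nom m))) \<in> \<Gamma>},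
     val = case_sum (\<lambda>p. {(g \<alpha>, h (rep n)) | \<alpha> n. (\<alpha>, At n (Pro p)) \<in> \<Gamma>})
                    (\<lambda>n. g ` T \<times> {h (rep n)})\<rparr>"

lemma parent_in_T: "Child \<alpha> n i \<in> T \<Longrightarrow> \<alpha> \<in> T"
  using seq unfolding tree_sequent_def tree_def by blast

lemma is_model_canonical: "is_model (canonical g h)"
proof -
  have "val (canonical g h) x \<subseteq> worlds (canonical g h) \<times> agents (canonical g h)" for x
    using tree_sequent_memD[OF seq] by (cases x) (auto simp: canonical_def)
  then show ?thesis
    unfolding is_model_def using T_nonempty parent_in_T
    by (auto simp: canonical_def times_eq_iff)
qed

lemma denot_canonical: "denot (canonical g h) n = h (rep n)"
  unfolding denot_def using T_nonempty
  by (intro the_equality) (auto simp: canonical_def times_eq_iff)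

lemma assignment_canonical: "assignment (canonical g h) T g"
  unfolding assignment_def denot_canonical by (auto simp: canonical_def)

text \<open>Two implications replace the usual equivalence. Each closure property turns a formula on
  a given side into smaller formulas on determined sides, so the induction never asks about a
  formula that is absent.\<close>

lemma truth_lemma:
  assumes "inj g" "inj h"
  shows "((\<alpha>, At n \<phi>) \<in> \<Gamma> \<longrightarrow> sat (canonical g h) (g \<alpha>) (h (rep n)) \<phi>) \<and>
         ((\<alpha>, At n \<phi>) \<in> \<Delta> \<longrightarrow> \<not> sat (canonical g h) (g \<alpha>) (h (rep n)) \<phi>)"
proof (induction \<phi> arbitrary: \<alpha> n)
  case (Nom m)
  have "eqn m n \<longleftrightarrow> (\<alpha>, At n (Nom m)) \<in> \<Gamma>" if "\<alpha> \<in> T"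
    using eqn_iff[OF that] eqn_sym by blast
  then show ?case
    using disjoint tree_sequent_memD[OF seq]
    by (auto simp: denot_canonical inj_eq[OF assms(2)] rep_eq_iff)
next
  case (Pro p)
  \<comment> \<open>The valuation sees only the class of \<open>n\<close>, so the formula on the
    left may have another prefix \<open>m\<close>; \<open>At_cong\<close> leads back to
    \<open>n\<close>.\<close>
  have "sat (canonical g h) (g \<alpha>) (h (rep n)) (Pro p) \<longleftrightarrow> (\<exists>m. eqn m n \<and> (\<alpha>, At m (Pro p)) \<in> \<Gamma>)"
    using eqn_sym by (auto simp: canonical_def inj_eq[OF assms(1)] inj_eq[OF assms(2)] rep_eq_iff)
  also have "\<dots> \<longleftrightarrow> (\<alpha>, At n (Pro p)) \<in> \<Gamma>"
    using At_cong eqn_refl by blast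
  finally show ?case using disjoint by blast
next
  case Bot
  then show ?case using not_Bot by auto
next
  case (Imp \<phi> \<psi>)
  then show ?case using ImpL_closed ImpR_closed by (metis sat.simps(4))
next
  case (At m \<phi>)
  then show ?case using AtL_closed AtR_closed by (auto simp: denot_canonical)
next
  case (Fr \<phi>)
  have friend: "(h (rep n), b) \<in> friend (canonical g h) (g \<alpha>) \<longleftrightarrow>
      (\<exists>m. b = h (rep m) \<and> (\<alpha>, At n (DiaF (Nom m))) \<in> \<Gamma>)" for b
    by (auto simp: canonical_def inj_eq[OF assms(1)] inj_eq[OF assms(2)] rep_eq_iff)
      (blast intro: eqn_refl eqn_sym At_cong)+
  show ?case
  proof (intro conjI impI)
    assume *: "(\<alpha>, At n (Fr \<phi>)) \<in> \<Gamma>"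
    \<comment> \<open>Every friend is named by such an \<open>m\<close>. \<open>FL_closed\<close>
      puts \<open>At m \<phi>\<close> on the left, since \<open>DiaF (Nom m)\<close> cannot also be
      on the right.\<close>
    have "sat (canonical g h) (g \<alpha>) (h (rep m)) \<phi>" if "(\<alpha>, At n (DiaF (Nom m))) \<in> \<Gamma>" for m
      using FL_closed[OF *, of m] disjoint[OF that] Fr.IH by blast
    then show "sat (canonical g h) (g \<alpha>) (h (rep n)) (Fr \<phi>)"
      by (auto simp: friend)
  next
    assume "(\<alpha>, At n (Fr \<phi>)) \<in> \<Delta>"
    then obtain m where "(\<alpha>, At n (DiaF (Nom m))) \<in> \<Gamma>" "(\<alpha>, At m \<phi>) \<in> \<Delta>"
      using witness_F by blast
    then show "\<not> sat (canonical g h) (g \<alpha>) (h (rep n)) (Fr \<phi>)"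
      using Fr.IH by (auto simp: friend)
  qed
next
  case (Box \<phi>)
  have know: "(g \<alpha>, v) \<in> know (canonical g h) (h (rep n)) \<longleftrightarrow>
      (\<exists>m i. v = g (Child \<alpha> m i) \<and> Child \<alpha> m i \<in> T \<and> eqn n m)" for v
    using eqn_sym
    by (auto simp: canonical_def inj_eq[OF assms(1)] inj_eq[OF assms(2)] rep_eq_iff)
  show ?case
  proof (intro conjI impI)
    assume *: "(\<alpha>, At n (Box \<phi>)) \<in> \<Gamma>"
    have "sat (canonical g h) (g (Child \<alpha> m i)) (h (rep n)) \<phi>"
      if "Child \<alpha> m i \<in> T" "eqn n m" for m i
    proof -
      \<comment> \<open>\<open>BoxL\<close> follows only edges that carry the prefix nominal, so the
        prefix becomes \<open>m\<close> first. The induction hypothesis then speaks of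
        \<open>m\<close>, whose representative is that of \<open>n\<close>.\<close>
      have "(Child \<alpha> m i, At m \<phi>) \<in> \<Gamma>"
        using At_cong[OF that(2) *] that(1) BoxL_closed by blast
      moreover have "rep n = rep m" using that(2) rep_eq_iff by blast
      ultimately show ?thesis using Box.IH by simp
    qed
    then show "sat (canonical g h) (g \<alpha>) (h (rep n)) (Box \<phi>)"
      by (auto simp: know)
  next
    assume "(\<alpha>, At n (Box \<phi>)) \<in> \<Delta>"
    then obtain i where "Child \<alpha> n i \<in> T" "(Child \<alpha> n i, At n \<phi>) \<in> \<Delta>"
      using witness_Box by blast
    then show "\<not> sat (canonical g h) (g \<alpha>) (h (rep n)) (Box \<phi>)"
      using Box.IH eqn_refl unfolding sat.simps know by blast
  qed
qed

lemma not_sat_sequent_canonical: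
  assumes "inj g" "inj h"
  shows "\<not> sat_sequent (canonical g h) g \<Gamma> \<Delta>"
proof -
  have "sat_lfm (canonical g h) g x" if "x \<in> \<Gamma>" for x
  proof -
    have "at_prefixed (snd x)"
      using tree_sequent_memD(1)[OF seq, of "fst x" "snd x"] that by simp
    then obtain \<alpha> n \<phi> where "x = (\<alpha>, At n \<phi>)"
      unfolding at_prefixed_def by (cases x) auto
    then show ?thesis
      using truth_lemma[OF assms] that by (auto simp: sat_lfm_def denot_canonical)
  qed
  moreover have "\<not> sat_lfm (canonical g h) g x" if "x \<in> \<Delta>" for x
    using truth_lemma[OF assms] that by (auto simp: sat_lfm_def denot_canonical)
  ultimately show ?thesis
    unfolding sat_sequent_def by blast
qed

end

section \<open>Extension to a saturated sequent\<close>

definition coinfinite :: "'a set \<Rightarrow> bool" where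
  "coinfinite A \<longleftrightarrow> infinite (- A)"

lemma coinfinite_Un_finite: "finite F \<Longrightarrow> coinfinite (F \<union> A) \<longleftrightarrow> coinfinite A"
  by (simp add: coinfinite_def Diff_infinite_finite Int_commute flip: Diff_eq Diff_Compl)

lemma coinfinite_insert: "coinfinite (insert x A) \<longleftrightarrow> coinfinite A"
  using coinfinite_Un_finite[of "{x}" A] by simp

lemma coinfinite_subset: "coinfinite B \<Longrightarrow> A \<subseteq> B \<Longrightarrow> coinfinite A"
  unfolding coinfinite_def by (meson Compl_subset_Compl_iff finite_subset)

lemma coinfinite_fresh: "coinfinite A \<Longrightarrow> \<exists>x. x \<notin> A"
  unfolding coinfinite_def by (metis ComplD finite.emptyI equals0I)

lemma seq_noms_insert:
  "seq_noms (insert x \<Gamma>) T \<Delta> = (lab_noms (fst x) \<union> noms (snd x)) \<union> seq_noms \<Gamma> T \<Delta>"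
  "seq_noms \<Gamma> T (insert x \<Delta>) = (lab_noms (fst x) \<union> noms (snd x)) \<union> seq_noms \<Gamma> T \<Delta>"
  "seq_noms \<Gamma> (insert \<alpha> T) \<Delta> = lab_noms \<alpha> \<union> seq_noms \<Gamma> T \<Delta>"
  unfolding seq_noms_def by (auto simp: case_prod_beta)

lemma seq_nats_insert:
  "seq_nats (insert x \<Gamma>) T \<Delta> = lab_nats (fst x) \<union> seq_nats \<Gamma> T \<Delta>"
  "seq_nats \<Gamma> T (insert x \<Delta>) = lab_nats (fst x) \<union> seq_nats \<Gamma> T \<Delta>"
  "seq_nats \<Gamma> (insert \<alpha> T) \<Delta> = lab_nats \<alpha> \<union> seq_nats \<Gamma> T \<Delta>"
  unfolding seq_nats_def by (auto simp: case_prod_beta)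

text \<open>The invariant of the single stages. Coinfiniteness survives finite additions, but not
  the passage to the limit, where all nominals occur.\<close>

definition extendable :: "('p, 'n) lfm set \<times> 'n label set \<times> ('p, 'n) lfm set \<Rightarrow> bool" where
  "extendable = (\<lambda>(\<Gamma>, T, \<Delta>). tree_sequent \<Gamma> T \<Delta> \<and> \<not> provable \<Gamma> T \<Delta> \<and>
     coinfinite (seq_noms \<Gamma> T \<Delta>) \<and> coinfinite (seq_nats \<Gamma> T \<Delta>))"

text \<open>A task \<open>(b, \<alpha>, \<psi>)\<close> asks to put \<open>\<alpha> : \<psi>\<close> on the left (\<open>b = True\<close>) or on the right
  (\<open>b = False\<close>), in the latter case together with a witness.\<close>

definition fulfils :: "bool \<times> ('p, 'n) lfm \<Rightarrow>
    ('p, 'n) lfm set \<times> 'n label set \<times> ('p, 'n) lfm set \<Rightarrow>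
    ('p, 'n) lfm set \<times> 'n label set \<times> ('p, 'n) lfm set \<Rightarrow> bool" where
  "fulfils = (\<lambda>(b, \<alpha>, \<psi>) (\<Gamma>, T, \<Delta>) (\<Gamma>', T', \<Delta>').
     \<Gamma> \<subseteq> \<Gamma>' \<and> T \<subseteq> T' \<and> \<Delta> \<subseteq> \<Delta>' \<and>
     (\<alpha> \<in> T \<and> at_prefixed \<psi> \<longrightarrow>
       (b \<and> \<not> provable (insert (\<alpha>, \<psi>) \<Gamma>) T \<Delta> \<longrightarrow> (\<alpha>, \<psi>) \<in> \<Gamma>') \<and>
       (\<not> b \<and> \<not> provable \<Gamma> T (insert (\<alpha>, \<psi>) \<Delta>) \<longrightarrow> (\<alpha>, \<psi>) \<in> \<Delta>' \<and>
          (\<forall>n \<phi>. \<psi> = At n (Fr \<phi>) \<longrightarrow>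
             (\<exists>m. (\<alpha>, At n (DiaF (Nom m))) \<in> \<Gamma>' \<and> (\<alpha>, At m \<phi>) \<in> \<Delta>')) \<and>
          (\<forall>n \<phi>. \<psi> = At n (Box \<phi>) \<longrightarrow>
             (\<exists>i. Child \<alpha> n i \<in> T' \<and> (Child \<alpha> n i, At n \<phi>) \<in> \<Delta>')))))"

text \<open>A fresh witness preserves unprovability: this is the contrapositive of
  \<open>provable_FR\<close> and \<open>provable_BoxR\<close>, applied after the principal formula
  has been added. Each case adds finitely many symbols.\<close>

lemma ex_fulfils:
  fixes S :: "('p, 'n::infinite) lfm set \<times> 'n label set \<times> ('p, 'n) lfm set"
  assumes "extendable S"
  shows "\<exists>S'. extendable S' \<and> fulfils t S S'"
proof -
  obtain \<Gamma> T \<Delta> b \<alpha> \<psi> where S: "S = (\<Gamma>, T, \<Delta>)" and t: "t = (b, \<alpha>, \<psi>)"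
    by (metis prod.exhaust)
  note simps = extendable_def seq_noms_insert seq_nats_insert coinfinite_Un_finite coinfinite_insert
  have ext: "tree_sequent \<Gamma> T \<Delta>" "\<not> provable \<Gamma> T \<Delta>"
    "coinfinite (seq_noms \<Gamma> T \<Delta>)" "coinfinite (seq_nats \<Gamma> T \<Delta>)"
    using assms S by (auto simp: extendable_def)
  \<comment> \<open>Among the idle cases is a label that has not yet entered the tree; such a task
    gets its chance when it recurs.\<close>
  consider (idle) "fulfils t S S"
    | (left) "b" "\<alpha> \<in> T" "at_prefixed \<psi>" "\<not> provable (insert (\<alpha>, \<psi>) \<Gamma>) T \<Delta>"
    | (right) "\<not> b" "\<alpha> \<in> T" "at_prefixed \<psi>" "\<not> provable \<Gamma> T (insert (\<alpha>, \<psi>) \<Delta>)"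
    unfolding S t fulfils_def by auto
  then show ?thesis
  proof cases
    case idle
    then show ?thesis using assms by blast
  next
    case left
    then have "extendable (insert (\<alpha>, \<psi>) \<Gamma>, T, \<Delta>)"
      using ext by (simp add: simps)
    moreover have "fulfils t S (insert (\<alpha>, \<psi>) \<Gamma>, T, \<Delta>)"
      using left by (auto simp: S t fulfils_def)
    ultimately show ?thesis by blast
  next
    case right
    let ?\<Delta> = "insert (\<alpha>, \<psi>) \<Delta>"
    have ext': "tree_sequent \<Gamma> T ?\<Delta>" "coinfinite (seq_noms \<Gamma> T ?\<Delta>)" "coinfinite (seq_nats \<Gamma> T ?\<Delta>)"
      using ext right by (simp_all add: simps)
    consider (F) n \<phi> where "\<psi> = At n (Fr \<phi>)" | (Box) n \<phi> where "\<psi> = At n (Box \<phi>)"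
      | (other) "\<nexists>n \<phi>. \<psi> = At n (Fr \<phi>) \<or> \<psi> = At n (Box \<phi>)" by blast
    then show ?thesis
    proof cases
      case F
      obtain m where m: "m \<notin> seq_noms \<Gamma> T ?\<Delta>" using coinfinite_fresh[OF ext'(2)] by blast
      let ?S = "(insert (\<alpha>, At n (DiaF (Nom m))) \<Gamma>, T, insert (\<alpha>, At m \<phi>) ?\<Delta>)"
      have "\<not> provable (insert (\<alpha>, At n (DiaF (Nom m))) \<Gamma>) T (insert (\<alpha>, At m \<phi>) ?\<Delta>)"
        using provable_FR[OF ext'(1) _ m] right F by blast
      then have "extendable ?S"
        using ext right by (simp add: simps)
      moreover have "fulfils t S ?S"
        using right F by (auto simp: S t fulfils_def)
      ultimately show ?thesis by blast
    next
      case Box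
      obtain i where i: "i \<notin> seq_nats \<Gamma> T ?\<Delta>" using coinfinite_fresh[OF ext'(3)] by blast
      let ?S = "(\<Gamma>, insert (Child \<alpha> n i) T, insert (Child \<alpha> n i, At n \<phi>) ?\<Delta>)"
      have "\<not> provable \<Gamma> (insert (Child \<alpha> n i) T) (insert (Child \<alpha> n i, At n \<phi>) ?\<Delta>)"
        using provable_BoxR[OF ext'(1) _ i] right Box by blast
      then have "extendable ?S"
        using ext right tree_sequent_insert_Child[OF ext(1) right(2)] by (simp add: simps)
      moreover have "fulfils t S ?S"
        using right Box by (auto simp: S t fulfils_def)
      ultimately show ?thesis by blast
    next
      case other
      then have "fulfils t S (\<Gamma>, T, ?\<Delta>)"
        using right by (auto simp: S t fulfils_def)
      moreover have "extendable (\<Gamma>, T, ?\<Delta>)"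
        using ext' right by (simp add: extendable_def)
      ultimately show ?thesis by blast
    qed
  qed
qed

text \<open>The bound is stated for all later \<open>k\<close>, so that the bounds of several chains
  can be combined by a maximum.\<close>

lemma finite_subset_chain:
  fixes A :: "nat \<Rightarrow> 'a set"
  assumes "mono A" "finite F" "F \<subseteq> (\<Union>k. A k)"
  obtains K where "\<And>k. k \<ge> K \<Longrightarrow> F \<subseteq> A k"
proof -
  have "\<exists>K. F \<subseteq> A K" using assms(2,3)
  proof (induction F)
    case (insert x F)
    then obtain K L where "F \<subseteq> A K" "x \<in> A L" by auto
    moreover have "A K \<subseteq> A (max K L)" "A L \<subseteq> A (max K L)"
      using assms(1) by (simp_all add: monoD)
    ultimately show ?case by (intro exI[of _ "max K L"]) auto
  qed auto
  then obtain K where "F \<subseteq> A K" by blast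
  then have "F \<subseteq> A k" if "k \<ge> K" for k
    using monoD[OF assms(1) that] by blast
  then show ?thesis using that by blast
qed

instance fm :: (countable, countable) countable
  by countable_datatype

instance label :: (countable) countable
  by countable_datatype

lemma ex_saturated:
  fixes \<Gamma> \<Delta> :: "('p::countable, 'n::{countable,infinite}) lfm set"
  assumes "extendable (\<Gamma>, T, \<Delta>)"
  shows "\<exists>\<Gamma>' T' \<Delta>'. \<Gamma> \<subseteq> \<Gamma>' \<and> T \<subseteq> T' \<and> \<Delta> \<subseteq> \<Delta>' \<and> saturated \<Gamma>' \<Delta>' T'"
proof -
  \<comment> \<open>The second component of the decoded pair is discarded, so every task recurs
    beyond every stage. This matters because labels may enter the tree late.\<close>
  define task :: "nat \<Rightarrow> bool \<times> ('p, 'n) lfm" where "task k = from_nat (fst (prod_decode k))" for k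
  have task: "\<exists>k\<ge>K. task k = t" for t K
    by (intro exI[of _ "prod_encode (to_nat t, K)"]) (simp add: task_def le_prod_encode_2)
  have "\<exists>S. \<forall>k. (extendable (S k) \<and> (k = 0 \<longrightarrow> S k = (\<Gamma>, T, \<Delta>))) \<and> fulfils (task k) (S k) (S (Suc k))"
  proof (rule dependent_nat_choice)
    show "\<exists>S. extendable S \<and> (0 = 0 \<longrightarrow> S = (\<Gamma>, T, \<Delta>))" using assms by blast
    show "\<exists>S'. (extendable S' \<and> (Suc k = 0 \<longrightarrow> S' = (\<Gamma>, T, \<Delta>))) \<and> fulfils (task k) S S'"
      if "extendable S \<and> (k = 0 \<longrightarrow> S = (\<Gamma>, T, \<Delta>))" for S k
      using ex_fulfils that by blast
  qed
  then obtain S where S0: "S 0 = (\<Gamma>, T, \<Delta>)" and "\<And>k. extendable (S k)"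
    "\<And>k. fulfils (task k) (S k) (S (Suc k))" by blast
  moreover define G U H where "G k = fst (S k)" and "U k = fst (snd (S k))" and "H k = snd (snd (S k))" for k
  ultimately have ext: "extendable (G k, U k, H k)"
    and ful: "fulfils (task k) (G k, U k, H k) (G (Suc k), U (Suc k), H (Suc k))" for k
    by simp_all
  have mono: "mono G" "mono U" "mono H"
    unfolding mono_iff_le_Suc
  proof -
    have "G k \<subseteq> G (Suc k) \<and> U k \<subseteq> U (Suc k) \<and> H k \<subseteq> H (Suc k)" for k
      using ful[of k] by (cases "task k") (simp add: fulfils_def)
    then show "\<forall>k. G k \<le> G (Suc k)" "\<forall>k. U k \<le> U (Suc k)" "\<forall>k. H k \<le> H (Suc k)"
      by blast+
  qed
  have seq: "tree_sequent (G k) (U k) (H k)" and unp: "\<not> provable (G k) (U k) (H k)" for k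
    using ext[of k] by (simp_all add: extendable_def)
  let ?G = "\<Union>k. G k" and ?U = "\<Union>k. U k" and ?H = "\<Union>k. H k"
  have Union_seq: "tree_sequent ?G ?U ?H"
    unfolding tree_sequent_def
  proof (intro conjI)
    have tr: "tree (U k)" for k using seq[of k] by (simp add: tree_sequent_def)
    obtain r where r: "Root r \<in> U 0" using tr[of 0] by (auto simp: tree_def)
    have root: "i = r" if "Root i \<in> U k" for i k
    proof -
      have "Root r \<in> U k" using r monoD[OF mono(2), of 0 k] by blast
      with that tr[of k] show ?thesis unfolding tree_def by blast
    qed
    show "tree ?U"
      unfolding tree_def
    proof (intro conjI allI impI)
      show "\<exists>!i. Root i \<in> ?U"
        using r root by (intro ex1I[of _ r]) blast+
      fix \<alpha> n i assume "Child \<alpha> n i \<in> ?U"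
      then obtain k where "Child \<alpha> n i \<in> U k" by blast
      with tr[of k] have "\<alpha> \<in> U k" unfolding tree_def by blast
      then show "\<alpha> \<in> ?U" by blast
    qed
    have "\<alpha> \<in> U k \<and> at_prefixed \<psi>" if "(\<alpha>, \<psi>) \<in> G k \<union> H k" for \<alpha> \<psi> k
      using tree_sequent_memD[OF seq[of k]] that by blast
    then show "\<forall>(\<alpha>, \<psi>) \<in> ?G \<union> ?H. \<alpha> \<in> ?U \<and> at_prefixed \<psi>"
      by blast
  qed
  have Union_unp: "\<not> provable ?G ?U ?H"
  proof
    assume "provable ?G ?U ?H"
    then obtain G' U' H' where *: "G' \<subseteq> ?G" "finite G'" "U' \<subseteq> ?U" "finite U'" "H' \<subseteq> ?H" "finite H'"
      and tree: "tree U'" "derivable G' U' H'"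
      unfolding provable_def by metis
    obtain K1 where 1: "\<And>k. k \<ge> K1 \<Longrightarrow> G' \<subseteq> G k" using finite_subset_chain[OF mono(1) *(2,1)] by blast
    obtain K2 where 2: "\<And>k. k \<ge> K2 \<Longrightarrow> U' \<subseteq> U k" using finite_subset_chain[OF mono(2) *(4,3)] by blast
    obtain K3 where 3: "\<And>k. k \<ge> K3 \<Longrightarrow> H' \<subseteq> H k" using finite_subset_chain[OF mono(3) *(6,5)] by blast
    \<comment> \<open>The finite derivable sequent fits into one single stage, which is
      unprovable.\<close>
    let ?k = "max K1 (max K2 K3)"
    have "provable (G ?k) (U ?k) (H ?k)"
      unfolding provable_def using 1[of ?k] 2[of ?k] 3[of ?k] * tree
      by (intro exI[of _ G'] exI[of _ U'] exI[of _ H']) simp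
    with unp show False by blast
  qed
  have stage: "\<exists>k. \<alpha> \<in> U k \<and> task k = t" if "\<alpha> \<in> ?U" for \<alpha> t
  proof -
    from that obtain K where "\<alpha> \<in> U K" by blast
    moreover obtain k where "k \<ge> K" "task k = t" using task by blast
    ultimately show ?thesis using monoD[OF mono(2), of K k] by blast
  qed
  have "saturated ?G ?H ?U"
  proof
    show "tree_sequent ?G ?U ?H" "\<not> provable ?G ?U ?H" by (fact Union_seq Union_unp)+
  next
    fix \<alpha> \<psi> assume "\<alpha> \<in> ?U" "at_prefixed \<psi>" "(\<alpha>, \<psi>) \<notin> ?G"
    moreover obtain k where "\<alpha> \<in> U k" "task k = (True, \<alpha>, \<psi>)"
      using stage[OF \<open>\<alpha> \<in> ?U\<close>, of "(True, \<alpha>, \<psi>)"] by blast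
    \<comment> \<open>Since the formula never enters the union, it was refused at stage
      \<open>k\<close>: adding it there already gave a provable sequent, and provability is
      monotone. The right-hand side is handled in the same way.\<close>
    moreover from this have "(\<alpha>, \<psi>) \<in> G (Suc k)" if "at_prefixed \<psi>" "\<not> provable (insert (\<alpha>, \<psi>) (G k)) (U k) (H k)"
      using ful[of k] that by (simp add: fulfils_def)
    ultimately have "provable (insert (\<alpha>, \<psi>) (G k)) (U k) (H k)"
      by blast
    then show "provable (insert (\<alpha>, \<psi>) ?G) ?U ?H"
      by (rule provable_mono) auto
  next
    fix \<alpha> \<psi> assume "\<alpha> \<in> ?U" "at_prefixed \<psi>" "(\<alpha>, \<psi>) \<notin> ?H"
    moreover obtain k where "\<alpha> \<in> U k" "task k = (False, \<alpha>, \<psi>)"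
      using stage[OF \<open>\<alpha> \<in> ?U\<close>, of "(False, \<alpha>, \<psi>)"] by blast
    moreover from this have "(\<alpha>, \<psi>) \<in> H (Suc k)" if "at_prefixed \<psi>" "\<not> provable (G k) (U k) (insert (\<alpha>, \<psi>) (H k))"
      using ful[of k] that by (simp add: fulfils_def)
    ultimately have "provable (G k) (U k) (insert (\<alpha>, \<psi>) (H k))"
      by blast
    then show "provable ?G ?U (insert (\<alpha>, \<psi>) ?H)"
      by (rule provable_mono) auto
  next
    fix \<alpha> n \<phi> assume "(\<alpha>, At n (Fr \<phi>)) \<in> ?H"
    then obtain j where "(\<alpha>, At n (Fr \<phi>)) \<in> H j" by blast
    moreover obtain k where "k \<ge> j" "task k = (False, \<alpha>, At n (Fr \<phi>))" using task by blast
    \<comment> \<open>The formula may have entered before its own task came up, for example as a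
      witness. When the task recurs, inserting the formula changes nothing, stage \<open>k\<close>
      is unprovable, and so the witness is supplied. The same holds for \<open>Box\<close>.\<close>
    ultimately have "(\<alpha>, At n (Fr \<phi>)) \<in> H k" "task k = (False, \<alpha>, At n (Fr \<phi>))"
      using monoD[OF mono(3), of j k] by blast+
    then show "\<exists>m. (\<alpha>, At n (DiaF (Nom m))) \<in> ?G \<and> (\<alpha>, At m \<phi>) \<in> ?H"
      unfolding UN_iff
      using ful[of k] unp[of k] tree_sequent_memD(2)[OF seq, of \<alpha> "At n (Fr \<phi>)" k]
      by (simp add: fulfils_def insert_absorb) blast
  next
    fix \<alpha> n \<phi> assume "(\<alpha>, At n (Box \<phi>)) \<in> ?H"
    then obtain j where "(\<alpha>, At n (Box \<phi>)) \<in> H j" by blast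
    moreover obtain k where "k \<ge> j" "task k = (False, \<alpha>, At n (Box \<phi>))" using task by blast
    ultimately have "(\<alpha>, At n (Box \<phi>)) \<in> H k" "task k = (False, \<alpha>, At n (Box \<phi>))"
      using monoD[OF mono(3), of j k] by blast+
    then show "\<exists>i. Child \<alpha> n i \<in> ?U \<and> (Child \<alpha> n i, At n \<phi>) \<in> ?H"
      unfolding UN_iff
      using ful[of k] unp[of k] tree_sequent_memD(2)[OF seq, of \<alpha> "At n (Box \<phi>)" k]
      by (simp add: fulfils_def insert_absorb) blast
  qed
  moreover have "\<Gamma> \<subseteq> ?G" "T \<subseteq> ?U" "\<Delta> \<subseteq> ?H"
    using S0 UN_upper[of 0 UNIV G] UN_upper[of 0 UNIV U] UN_upper[of 0 UNIV H]
    by (simp_all add: G_def U_def H_def)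
  ultimately show ?thesis
    by (intro exI[of _ ?G] exI[of _ ?U] exI[of _ ?H] conjI)
qed

section \<open>Transfer between the two languages\<close>

text \<open>Relabelling preserves the shape of labels: only roots become roots and parents become
  parents. So trees stay trees even when labels are identified.\<close>

lemma tree_relab: "tree T \<Longrightarrow> tree (relab \<sigma> \<tau> ` T)"
proof -
  assume T: "tree T"
  have Root: "relab \<sigma> \<tau> \<alpha> = Root i \<longleftrightarrow> (\<exists>j. \<alpha> = Root j \<and> \<tau> j = i)" for \<alpha> i
    by (cases \<alpha>) auto
  have Child: "relab \<sigma> \<tau> \<alpha> = Child \<beta> n i \<longleftrightarrow>
      (\<exists>\<gamma> m j. \<alpha> = Child \<gamma> m j \<and> relab \<sigma> \<tau> \<gamma> = \<beta> \<and> \<sigma> m = n \<and> \<tau> j = i)" for \<alpha> \<beta> n i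
    by (cases \<alpha>) auto
  obtain r where "Root r \<in> T" "\<And>i. Root i \<in> T \<Longrightarrow> i = r"
    using T unfolding tree_def by blast
  then have "\<exists>!i. Root i \<in> relab \<sigma> \<tau> ` T"
  proof (intro ex1I[of _ "\<tau> r"])
    show "Root (\<tau> r) \<in> relab \<sigma> \<tau> ` T"
      using \<open>Root r \<in> T\<close> by (metis image_eqI relab.simps(1))
    fix i assume "Root i \<in> relab \<sigma> \<tau> ` T"
    then obtain \<alpha> where "\<alpha> \<in> T" "relab \<sigma> \<tau> \<alpha> = Root i" by (metis imageE)
    then show "i = \<tau> r" using \<open>\<And>i. Root i \<in> T \<Longrightarrow> i = r\<close> unfolding Root by blast
  qed
  moreover have "\<beta> \<in> relab \<sigma> \<tau> ` T" if "Child \<beta> n i \<in> relab \<sigma> \<tau> ` T" for \<beta> n i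
  proof -
    from that obtain \<alpha> where "\<alpha> \<in> T" "relab \<sigma> \<tau> \<alpha> = Child \<beta> n i" by (metis imageE)
    then show ?thesis using T unfolding Child tree_def by blast
  qed
  ultimately show ?thesis unfolding tree_def by blast
qed

lemma tree_sequent_rename:
  "tree_sequent \<Gamma> T \<Delta> \<Longrightarrow> tree_sequent (relfm \<sigma> \<tau> ` \<Gamma>) (relab \<sigma> \<tau> ` T) (relfm \<sigma> \<tau> ` \<Delta>)"
  by (force simp: tree_sequent_def relfm_def tree_relab)

text \<open>Brings a proof in the larger language back along the left inverses \<open>fst\<close>
  and halving, neither of which is injective.\<close>

lemma provable_rename:
  fixes \<sigma> :: "'n \<Rightarrow> 'm::infinite" and \<Gamma> \<Delta> :: "('p, 'n) lfm set"
  assumes "provable \<Gamma> T \<Delta>"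
  shows "provable (relfm \<sigma> \<tau> ` \<Gamma>) (relab \<sigma> \<tau> ` T) (relfm \<sigma> \<tau> ` \<Delta>)"
proof -
  obtain \<Gamma>' T' \<Delta>' where *: "\<Gamma>' \<subseteq> \<Gamma>" "finite \<Gamma>'" "T' \<subseteq> T" "finite T'" "tree T'" "\<Delta>' \<subseteq> \<Delta>" "finite \<Delta>'"
    and d: "derivable \<Gamma>' T' \<Delta>'"
    using assms unfolding provable_def by metis
  have "fin_tree_sequent (relfm \<sigma> \<tau> ` \<Gamma>') (relab \<sigma> \<tau> ` T') (relfm \<sigma> \<tau> ` \<Delta>')"
    using derivable_fin_tree_sequent[OF d] tree_sequent_rename by (auto simp: fin_tree_sequent_def)
  then have "derivable (relfm \<sigma> \<tau> ` \<Gamma>') (relab \<sigma> \<tau> ` T') (relfm \<sigma> \<tau> ` \<Delta>')"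
    using derivable_rename[OF d subset_refl subset_refl subset_refl] by blast
  then show ?thesis
    unfolding provable_def using *
    by (intro exI[of _ "relfm \<sigma> \<tau> ` \<Gamma>'"] exI[of _ "relab \<sigma> \<tau> ` T'"] exI[of _ "relfm \<sigma> \<tau> ` \<Delta>'"])
      (simp add: image_mono tree_relab)
qed

lemma lab_noms_relab: "lab_noms (relab \<sigma> \<tau> \<alpha>) = \<sigma> ` lab_noms \<alpha>"
  by (induction \<alpha>) auto

lemma lab_nats_relab: "lab_nats (relab \<sigma> \<tau> \<alpha>) = \<tau> ` lab_nats \<alpha>"
  by (induction \<alpha>) auto

lemma seq_noms_rename: "seq_noms (relfm \<sigma> \<tau> ` \<Gamma>) (relab \<sigma> \<tau> ` T) (relfm \<sigma> \<tau> ` \<Delta>) \<subseteq> range \<sigma>"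
  by (auto simp: seq_noms_def relfm_def lab_noms_relab fm.set_map)

lemma seq_nats_rename: "seq_nats (relfm \<sigma> \<tau> ` \<Gamma>) (relab \<sigma> \<tau> ` T) (relfm \<sigma> \<tau> ` \<Delta>) \<subseteq> range \<tau>"
  by (auto simp: seq_nats_def relfm_def lab_nats_relab)

definition reduct :: "('n \<Rightarrow> 'm) \<Rightarrow> ('w, 'a, 'p, 'm) model \<Rightarrow> ('w, 'a, 'p, 'n) model" where
  "reduct \<sigma> M = \<lparr>worlds = worlds M, agents = agents M, know = know M, friend = friend M,
     val = \<lambda>x. val M (map_sum id \<sigma> x)\<rparr>"

lemma is_model_reduct: "is_model M \<Longrightarrow> is_model (reduct \<sigma> M)"
  by (simp add: is_model_def reduct_def)

lemma denot_reduct: "denot (reduct \<sigma> M) n = denot M (\<sigma> n)"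
  by (simp add: denot_def reduct_def)

lemma sat_reduct: "sat (reduct \<sigma> M) w a \<phi> \<longleftrightarrow> sat M w a (map_fm id \<sigma> \<phi>)"
  by (induction \<phi> arbitrary: w a) (simp_all add: denot_reduct, simp_all add: reduct_def)

lemma sat_lfm_reduct: "sat_lfm (reduct \<sigma> M) (f \<circ> relab \<sigma> \<tau>) x \<longleftrightarrow> sat_lfm M f (relfm \<sigma> \<tau> x)"
proof (cases x)
  case (Pair \<alpha> \<psi>)
  then show ?thesis
    by (cases \<psi>) (auto simp: sat_lfm_def denot_reduct sat_reduct)
qed

lemma assignment_reduct:
  "assignment M (relab \<sigma> \<tau> ` T) f \<Longrightarrow> assignment (reduct \<sigma> M) T (f \<circ> relab \<sigma> \<tau>)"
  unfolding assignment_def denot_reduct by (force simp: reduct_def)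

text \<open>Places the labels and nominals of the countermodel inside the given types of worlds and
  agents.\<close>

lemma ex_inj_countable_infinite: "\<exists>f :: 'b::countable \<Rightarrow> 'c::infinite. inj f"
proof -
  obtain f :: "nat \<Rightarrow> 'c" where "inj f"
    using arb_countable_map[of "{}"] by blast
  then have "inj (f \<circ> (to_nat :: 'b \<Rightarrow> nat))"
    by (intro inj_compose) simp_all
  then show ?thesis by blast
qed

section \<open>Completeness\<close>

text \<open>Truth is assumed only in models over one fixed pair of infinite types. This is enough
  because the countermodel is countable and can be copied into them.\<close>

theorem theorem2:
  fixes \<Gamma> \<Delta> :: "('p::{countable,infinite}, 'n::{countable,infinite}) lfm set"
    and T :: "'n label set"
  assumes "tree_sequent \<Gamma> T \<Delta>"
    and "\<And>(M :: ('w::infinite, 'a::infinite, 'p, 'n) model) f.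
           is_model M \<Longrightarrow> assignment M T f \<Longrightarrow> sat_sequent M f \<Gamma> \<Delta>"
  shows "provable \<Gamma> T \<Delta>"
proof (rule ccontr)
  assume unprovable: "\<not> provable \<Gamma> T \<Delta>"
  \<comment> \<open>The original nominals become the copies tagged \<open>False\<close>; those
    tagged \<open>True\<close> stay fresh.\<close>
  define \<sigma> :: "'n \<Rightarrow> 'n \<times> bool" where "\<sigma> n = (n, False)" for n
  \<comment> \<open>The original numbers become even; the odd ones stay fresh.\<close>
  define \<tau> :: "nat \<Rightarrow> nat" where "\<tau> i = 2 * i" for i
  have inverse: "fst \<circ> \<sigma> = id" "(\<lambda>i. i div 2) \<circ> \<tau> = id"
    by (auto simp: \<sigma>_def \<tau>_def)
  let ?\<Gamma> = "relfm \<sigma> \<tau> ` \<Gamma>" and ?T = "relab \<sigma> \<tau> ` T" and ?\<Delta> = "relfm \<sigma> \<tau> ` \<Delta>"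
  have "\<not> provable ?\<Gamma> ?T ?\<Delta>"
  proof
    assume "provable ?\<Gamma> ?T ?\<Delta>"
    from provable_rename[OF this, of fst "\<lambda>i. i div 2"] have "provable \<Gamma> T \<Delta>"
      by (simp add: image_image relfm_relfm relab_relab inverse)
    with unprovable show False ..
  qed
  moreover have "coinfinite (seq_noms ?\<Gamma> ?T ?\<Delta>)"
  proof -
    have "range (\<lambda>n. (n, True)) \<subseteq> - range \<sigma>"
      by (auto simp: \<sigma>_def)
    moreover have "infinite (range (\<lambda>n :: 'n. (n, True)))"
      by (simp add: finite_image_iff inj_def infinite_UNIV)
    ultimately have "coinfinite (range \<sigma>)"
      unfolding coinfinite_def by (rule infinite_super)
    then show ?thesis
      using seq_noms_rename by (rule coinfinite_subset)
  qed
  moreover have "coinfinite (seq_nats ?\<Gamma> ?T ?\<Delta>)"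
  proof -
    have "range (\<lambda>i :: nat. Suc (2 * i)) \<subseteq> - range \<tau>"
      by (auto simp: \<tau>_def dest: arg_cong[of _ _ even])
    moreover have "infinite (range (\<lambda>i :: nat. Suc (2 * i)))"
      by (simp add: finite_image_iff inj_def)
    ultimately have "coinfinite (range \<tau>)"
      unfolding coinfinite_def by (rule infinite_super)
    then show ?thesis
      using seq_nats_rename by (rule coinfinite_subset)
  qed
  ultimately have "extendable (?\<Gamma>, ?T, ?\<Delta>)"
    unfolding extendable_def prod.case
    by (intro conjI tree_sequent_rename[OF assms(1)])
  from ex_saturated[OF this] obtain \<Gamma>' T' \<Delta>'
    where sub: "?\<Gamma> \<subseteq> \<Gamma>'" "?T \<subseteq> T'" "?\<Delta> \<subseteq> \<Delta>'" and "saturated \<Gamma>' \<Delta>' T'"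
    by (elim exE conjE)
  interpret saturated \<Gamma>' \<Delta>' T' by fact
  obtain g :: "('n \<times> bool) label \<Rightarrow> 'w" and h :: "'n \<times> bool \<Rightarrow> 'a" where inj: "inj g" "inj h"
    using ex_inj_countable_infinite by metis
  have "assignment (canonical g h) ?T g"
    using assignment_canonical[of g h] sub(2) unfolding assignment_def by blast
  then have sat: "sat_sequent (reduct \<sigma> (canonical g h)) (g \<circ> relab \<sigma> \<tau>) \<Gamma> \<Delta>"
    by (intro assms(2) is_model_reduct is_model_canonical assignment_reduct)
  \<comment> \<open>If all of \<open>\<Gamma>'\<close> is true, so is the renamed
    \<open>\<Gamma>\<close>. The assumption, applied to the reduct, then makes a formula of the
    renamed \<open>\<Delta>\<close> true, and this lies in \<open>\<Delta>'\<close>.\<close>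
  have "sat_sequent (canonical g h) g \<Gamma>' \<Delta>'"
    unfolding sat_sequent_def
  proof
    assume true: "\<forall>x\<in>\<Gamma>'. sat_lfm (canonical g h) g x"
    have "sat_lfm (canonical g h) g (relfm \<sigma> \<tau> x)" if "x \<in> \<Gamma>" for x
      using true sub(1) that by (simp add: image_subset_iff)
    then obtain x where "x \<in> \<Delta>" "sat_lfm (canonical g h) g (relfm \<sigma> \<tau> x)"
      using sat unfolding sat_sequent_def sat_lfm_reduct by blast
    then show "\<exists>x\<in>\<Delta>'. sat_lfm (canonical g h) g x"
      using sub(3) by (meson image_subset_iff)
  qed
  with not_sat_sequent_canonical[OF inj] show False ..
qed

end
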